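(* Let $\vartheta$ be a compatible, irreducible Pisot random substitution on the alphabet $\mathcal A=\{1,\dots,d\}$, and let $w\in X_\vartheta^\infty$ be an element with dense shift-orbit in $X_\vartheta$. Then, for all $a\in\mathcal A$, $$\mathcal R_a(w)=\widehat{\mathcal R}_{\vartheta,a}.$$
   Context: Words: $\mathcal A^+$ is the set of non-empty finite words over $\mathcal A=\{1,\dots,d\}$, and $\mathcal A^*=\mathcal A^+\cup\{\varepsilon\}$ with $\varepsilon$ the empty word. $|u|_i$ is the number of occurrences of the letter $i$ in $u$, and $\psi(u)=(|u|_1,\dots,|u|_d)^T$ is the abelianisation vector. $x_{[i,j]}=x_i\cdots x_j$ (empty if $j<i$). $\mathcal A^{\mathbb N}$ has the product topology and $S$ is the left shift; the shift-orbit of $x$ is $\{S^n x:n\ge 0\}$. Random substitution (set-valued part): a map $\vartheta$ assigning to each letter a non-empty finite subset of $\mathcal A^+$ (the probabilities attached to realisations play no role here). For $u=u_1\cdots u_n$ put $\vartheta(u)=\{v_1\cdots v_n: v_i\in\vartheta(u_i)\}$, and similarly for infinite sequences; $\vartheta(X)=\bigcup_{x\in X}\vartheta(x)$; $\vartheta^0(u)=\{u\}$ and $\vartheta^{n+1}(u)=\bigcup_{v\in\vartheta^n(u)}\vartheta(v)$. It is compatible if $\psi(u)=\psi(v)$ for all $a\in\mathcal A$ and $u,v\in\vartheta(a)$; then the substitution matrix is $M_{i,j}=|v|_i$ for any $v\in\vartheta(j)$. It is primitive if $M$ is primitive with Perron–Frobenius eigenvalue $\lambda>1$. A compatible primitive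 $\vartheta$ is irreducible Pisot if $\lambda$ is a Pisot number (an algebraic integer $>1$ all of whose other Galois conjugates have modulus $<1$) and the characteristic polynomial of $M$ is irreducible over $\mathbb Z$. A word $u\in\mathcal A^+$ is legal if it is a subword of some element of $\vartheta^k(a)$ with $a\in\mathcal A$, $k\in\mathbb N$. $X_\vartheta$ is the set of $x\in\mathcal A^{\mathbb N}$ all of whose finite subwords are legal, and $X_\vartheta^\infty=\bigcap_{n\ge0}\vartheta^n(X_\vartheta)$. Let $\mathbf L,\mathbf R$ be left and right Perron–Frobenius eigenvectors of $M$, with $\|\mathbf R\|_1=1=\mathbf L^T\mathbf R$; $\mathbb H\subset\mathbb R^d$ is the hyperplane orthogonal to $\mathbf L$; $\pi$ is the linear projection along $\mathbf R$ onto $\mathbb H$. For $w\in X_\vartheta$ and $a\in\mathcal A$: $\mathcal S_a(w)=\{\psi(w_{[1,n]}):n\ge0,\ w_{n+1}=a\}$ and $\mathcal R_a(w)=\overline{\pi(\mathcal S_a(w))}$. Prefix construction: $\mathcal A_1$ is the set of letters $a$ for which there is $b\in\mathcal A$ such that $a$ is the first letter of some element of $\vartheta^n(b)$ for infinitely many $n\in\mathbb N$. The prefix language is $\mathcal L_{\vartheta,p}=\{v\in\mathcal A^+: v\text{ is a prefix of some }w\in\vartheta^k(a),\ k\ge 0,\ a\in\mathcal A_1\}$. Set $\mathcal S_a(\mathcal L_{\vartheta,p})=\{\psi(v):v\in\mathcal A^*,\ va\in\mathcal L_{\vartheta,p}\}$ and $\widehat{\mathcal R}_{\vartheta,a}=\overline{\pi(\mathcal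 S_a(\mathcal L_{\vartheta,p}))}$. *)

theory Defs
  imports "HOL-Analysis.Analysis" "HOL-Library.Sublist"
    "HOL-Computational_Algebra.Computational_Algebra"
begin

text \<open>
  The alphabet \<open>{1,\<dots>,d}\<close> is rendered by a finite type \<open>'a\<close>, so that \<open>d = CARD('a)\<close> and
  \<open>\<real>\<^sup>d\<close> is \<open>real ^ 'a\<close>.  Finite words are lists.  An infinite sequence is a function
  \<open>x :: nat \<Rightarrow> 'a\<close> indexed from \<open>0\<close>: its \<open>(n+1)\<close>-st letter is \<open>x n\<close>, and its prefix of length
  \<open>n\<close> is \<open>map x [0..<n]\<close>.
\<close>

definition abel :: "'a list \<Rightarrow> real ^ 'a::finite" where
  "abel u = (\<chi> i. real (count_list u i))"

definition shift :: "(nat \<Rightarrow> 'a) \<Rightarrow> nat \<Rightarrow> 'a" where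
  "shift x = (\<lambda>n. x (Suc n))"

definition shift_orbit :: "(nat \<Rightarrow> 'a) \<Rightarrow> (nat \<Rightarrow> 'a) set" where
  "shift_orbit x = {(shift ^^ n) x | n. True}"

definition full_shift :: "(nat \<Rightarrow> 'a) topology" where
  "full_shift = product_topology (\<lambda>_. discrete_topology UNIV) UNIV"


subsection \<open>Random substitutions (set-valued part)\<close>

definition random_subst :: "('a::finite \<Rightarrow> 'a list set) \<Rightarrow> bool" where
  "random_subst \<theta> \<longleftrightarrow> (\<forall>a. \<theta> a \<noteq> {} \<and> finite (\<theta> a) \<and> [] \<notin> \<theta> a)"

definition subst_word :: "('a \<Rightarrow> 'a list set) \<Rightarrow> 'a list \<Rightarrow> 'a list set" where
  "subst_word \<theta> u = {concat vs | vs. list_all2 (\<lambda>v a. v \<in> \<theta> a) vs u}"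

definition subst_lang :: "('a \<Rightarrow> 'a list set) \<Rightarrow> 'a list set \<Rightarrow> 'a list set" where
  "subst_lang \<theta> U = (\<Union>u\<in>U. subst_word \<theta> u)"

definition subst_iter :: "('a \<Rightarrow> 'a list set) \<Rightarrow> nat \<Rightarrow> 'a list \<Rightarrow> 'a list set" where
  "subst_iter \<theta> n u = (subst_lang \<theta> ^^ n) {u}"

text \<open>
  The infinite concatenation \<open>v 0 \<cdot> v 1 \<cdot> \<dots>\<close> is the sequence having every finite concatenation
  \<open>v 0 \<cdots> v (n - 1)\<close> as a prefix; this determines it uniquely since all \<open>v i\<close> are non-empty.
\<close>

definition is_inf_concat :: "(nat \<Rightarrow> 'a list) \<Rightarrow> (nat \<Rightarrow> 'a) \<Rightarrow> bool" where
  "is_inf_concat v y \<longleftrightarrow>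
     (\<forall>n. let p = concat (map v [0..<n]) in map y [0..<length p] = p)"

definition subst_seq :: "('a \<Rightarrow> 'a list set) \<Rightarrow> (nat \<Rightarrow> 'a) \<Rightarrow> (nat \<Rightarrow> 'a) set" where
  "subst_seq \<theta> x = {y. \<exists>v. (\<forall>i. v i \<in> \<theta> (x i)) \<and> is_inf_concat v y}"

definition subst_seqs :: "('a \<Rightarrow> 'a list set) \<Rightarrow> (nat \<Rightarrow> 'a) set \<Rightarrow> (nat \<Rightarrow> 'a) set" where
  "subst_seqs \<theta> X = (\<Union>x\<in>X. subst_seq \<theta> x)"

definition compatible :: "('a::finite \<Rightarrow> 'a list set) \<Rightarrow> bool" where
  "compatible \<theta> \<longleftrightarrow> (\<forall>a. \<forall>u\<in>\<theta> a. \<forall>v\<in>\<theta> a. abel u = abel v)"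

text \<open>
  The substitution matrix is polymorphic in the type of its entries, so that it can be used
  both over \<open>int\<close> (characteristic polynomial) and over \<open>real\<close>.
\<close>

definition subst_matrix :: "('a::finite \<Rightarrow> 'a list set) \<Rightarrow> 'b::semiring_1 ^ 'a ^ 'a" where
  "subst_matrix \<theta> = (\<chi> i j. of_nat (count_list (SOME v. v \<in> \<theta> j) i))"

lemma subst_matrix_nth:
  assumes "compatible \<theta>" "v \<in> \<theta> j"
  shows "subst_matrix \<theta> $ i $ j = of_nat (count_list v i)"
proof -
  have "(SOME v. v \<in> \<theta> j) \<in> \<theta> j"
    using assms(2) by (rule someI)
  hence "abel (SOME v. v \<in> \<theta> j) = abel v"
    using assms unfolding compatible_def by blast
  thus ?thesis
    by (simp add: subst_matrix_def abel_def vec_eq_iff)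
qed


subsection \<open>Perron--Frobenius data and the Pisot condition\<close>

definition charpoly :: "'b::comm_ring_1 ^ 'n ^ 'n \<Rightarrow> 'b poly" where
  "charpoly M = det (mat [:0, 1:] - (\<chi> i j. [:M $ i $ j:]))"

definition primitive_matrix :: "real ^ 'n ^ 'n \<Rightarrow> bool" where
  "primitive_matrix M \<longleftrightarrow>
     (\<forall>i j. M $ i $ j \<ge> 0) \<and> (\<exists>k>0. \<forall>i j. ((\<lambda>A. M ** A) ^^ k) (mat 1) $ i $ j > 0)"

text \<open>
  The Perron--Frobenius eigenvalue of a primitive matrix is its spectral radius, i.e.\ the
  largest modulus of a complex eigenvalue.
\<close>

definition complex_eigenvalues :: "real ^ 'n ^ 'n \<Rightarrow> complex set" where
  "complex_eigenvalues M =
     {\<mu>. \<exists>v. v \<noteq> 0 \<and> (\<chi> i j. complex_of_real (M $ i $ j)) *v v = \<mu> *s v}"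

definition pf_eigenvalue :: "real ^ 'n ^ 'n \<Rightarrow> real" where
  "pf_eigenvalue M = Max (cmod ` complex_eigenvalues M)"

definition right_pf_eigenvector :: "real ^ 'n ^ 'n \<Rightarrow> real ^ 'n \<Rightarrow> bool" where
  "right_pf_eigenvector M R \<longleftrightarrow> (\<forall>i. R $ i > 0) \<and> M *v R = pf_eigenvalue M *s R"

definition left_pf_eigenvector :: "real ^ 'n ^ 'n \<Rightarrow> real ^ 'n \<Rightarrow> bool" where
  "left_pf_eigenvector M L \<longleftrightarrow> (\<forall>i. L $ i > 0) \<and> L v* M = pf_eigenvalue M *s L"

text \<open>
  For algebraic \<open>x\<close>, an irreducible integer polynomial vanishing at \<open>x\<close> is a rational multiple
  of the minimal polynomial of \<open>x\<close>.
\<close>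

definition galois_conjugates :: "real \<Rightarrow> complex set" where
  "galois_conjugates x =
     {z. \<exists>p::int poly. irreducible p \<and> poly (map_poly of_int p) x = 0
                     \<and> poly (map_poly of_int p) z = 0}"

definition pisot_number :: "real \<Rightarrow> bool" where
  "pisot_number x \<longleftrightarrow>
     algebraic_int x \<and> x > 1 \<and> (\<forall>z\<in>galois_conjugates x - {complex_of_real x}. cmod z < 1)"

definition primitive_subst :: "('a::finite \<Rightarrow> 'a list set) \<Rightarrow> bool" where
  "primitive_subst \<theta> \<longleftrightarrow>
     primitive_matrix (subst_matrix \<theta>) \<and> pf_eigenvalue (subst_matrix \<theta>) > 1"

definition irreducible_pisot :: "('a::finite \<Rightarrow> 'a list set) \<Rightarrow> bool" where
  "irreducible_pisot \<theta> \<longleftrightarrow>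
     compatible \<theta> \<and> primitive_subst \<theta> \<and> pisot_number (pf_eigenvalue (subst_matrix \<theta>))
     \<and> irreducible (charpoly (subst_matrix \<theta> :: int ^ 'a ^ 'a))"


subsection \<open>The subshifts\<close>

definition legal :: "('a \<Rightarrow> 'a list set) \<Rightarrow> 'a list \<Rightarrow> bool" where
  "legal \<theta> u \<longleftrightarrow> u \<noteq> [] \<and> (\<exists>a k. \<exists>v\<in>subst_iter \<theta> k [a]. sublist u v)"

definition subshift :: "('a \<Rightarrow> 'a list set) \<Rightarrow> (nat \<Rightarrow> 'a) set" where
  "subshift \<theta> = {x. \<forall>i j. i < j \<longrightarrow> legal \<theta> (map x [i..<j])}"

definition subshift_inf :: "('a \<Rightarrow> 'a list set) \<Rightarrow> (nat \<Rightarrow> 'a) set" where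
  "subshift_inf \<theta> = (\<Inter>n. (subst_seqs \<theta> ^^ n) (subshift \<theta>))"


subsection \<open>Rauzy fractals\<close>

definition pf_hyperplane :: "real ^ 'n \<Rightarrow> (real ^ 'n) set" where
  "pf_hyperplane L = {y. L \<bullet> y = 0}"

definition pf_proj :: "real ^ 'n \<Rightarrow> real ^ 'n \<Rightarrow> real ^ 'n \<Rightarrow> real ^ 'n" where
  "pf_proj L R x = (THE y. y \<in> pf_hyperplane L \<and> x - y \<in> span {R})"

lemma pf_proj_eq:
  assumes "L \<bullet> R = 1"
  shows "pf_proj L R x = x - (L \<bullet> x) *\<^sub>R R"
  unfolding pf_proj_def
proof (rule the_equality)
  show "x - (L \<bullet> x) *\<^sub>R R \<in> pf_hyperplane L \<and> x - (x - (L \<bullet> x) *\<^sub>R R) \<in> span {R}"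
    using assms by (simp add: pf_hyperplane_def inner_diff_right span_mul span_base)
next
  fix y assume y: "y \<in> pf_hyperplane L \<and> x - y \<in> span {R}"
  then obtain c where c: "x - y = c *\<^sub>R R"
    by (auto simp: span_singleton)
  have "L \<bullet> x = L \<bullet> (x - y)"
    using y by (simp add: pf_hyperplane_def inner_diff_right)
  also have "\<dots> = c"
    using assms by (simp add: c)
  finally show "y = x - (L \<bullet> x) *\<^sub>R R"
    using c by (simp add: algebra_simps)
qed

definition prefix_abels :: "(nat \<Rightarrow> 'a::finite) \<Rightarrow> 'a \<Rightarrow> (real ^ 'a) set" where
  "prefix_abels w a = {abel (map w [0..<n]) | n. w n = a}"

definition rauzy :: "real ^ 'a \<Rightarrow> real ^ 'a \<Rightarrow> (nat \<Rightarrow> 'a::finite) \<Rightarrow> 'a \<Rightarrow> (real ^ 'a) set" where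
  "rauzy L R w a = closure (pf_proj L R ` prefix_abels w a)"

definition initial_letters :: "('a \<Rightarrow> 'a list set) \<Rightarrow> 'a set" where
  "initial_letters \<theta> = {a. \<exists>b. infinite {n. \<exists>v\<in>subst_iter \<theta> n [b]. prefix [a] v}}"

definition prefix_language :: "('a \<Rightarrow> 'a list set) \<Rightarrow> 'a list set" where
  "prefix_language \<theta> =
     {v. v \<noteq> [] \<and> (\<exists>k. \<exists>a\<in>initial_letters \<theta>. \<exists>w\<in>subst_iter \<theta> k [a]. prefix v w)}"

definition language_abels :: "'a list set \<Rightarrow> 'a \<Rightarrow> (real ^ 'a::finite) set" where
  "language_abels \<L> a = {abel v | v. v @ [a] \<in> \<L>}"

definition rauzy_hat ::
    "real ^ 'a \<Rightarrow> real ^ 'a \<Rightarrow> ('a::finite \<Rightarrow> 'a list set) \<Rightarrow> 'a \<Rightarrow> (real ^ 'a) set" where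
  "rauzy_hat L R \<theta> a = closure (pf_proj L R ` language_abels (prefix_language \<theta>) a)"

end

theory Submission
  imports Defs
begin

text \<open>
  Write \<open>\<psi>\<close> for the abelianisation, \<open>\<pi>\<close> for the projection along \<open>R\<close>, and call \<open>\<pi> (\<psi> u)\<close> the position
  of a word \<open>u\<close>.  Both fractals are closures of sets of positions: of prefixes of \<open>w\<close> that are
  followed by \<open>a\<close>, and of words \<open>v\<close> such that \<open>v a\<close> is in the prefix language.

  The first set is contained in the second because every prefix of \<open>w\<close> is in the prefix language:
  as \<open>w\<close> can be desubstituted arbitrarily often, a pigeonhole argument on the letters at the
  beginning of its ancestors finds an initial letter above the prefix
  (\<open>prefix_in_prefix_language\<close>).

  For the converse one has to find a given word \<open>v a\<close> of the prefix language in \<open>w\<close>, preceded by a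
  prefix whose position is close to \<open>0\<close>.  Denseness of the orbit provides an occurrence of every
  legal word in \<open>w\<close>, but at a place over which one has no control; desubstituting \<open>w\<close> does not help,
  since it does not determine which realisation of a letter appears in \<open>w\<close>.  The way out is a
  rigidity argument.  The set \<open>D\<close> of all positions in the prefix language is bounded
  (\<open>bounded_pos_prefix_language\<close>).  Since realisations can be chosen independently, there is a
  single legal word \<open>W\<close> whose prefixes approximate simultaneously the given position and all points
  of a fine finite net of \<open>D\<close> (\<open>legal_word_realising\<close>).  If \<open>W\<close> occurs in \<open>w\<close> after a prefix with
  position \<open>t\<close>, then \<open>t + D\<close> nearly lies in \<open>D\<close> by the first inclusion, and for a bounded set this
  forces \<open>t\<close> to be small (\<open>translation_small_if_almost_preserves\<close>).

  Boundedness of \<open>D\<close> and the approximation both rest on one analytic fact: the series of the norms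
  of \<open>\<pi> (M\<^sup>n x)\<close> converges for every \<open>x\<close> (\<open>summable_\<pi>_M_pow\<close>).  As \<open>\<pi>\<close> commutes with \<open>M\<close>, this concerns \<open>M\<close>
  on the hyperplane orthogonal to \<open>L\<close>.  Its eigenvalues there are Galois conjugates of the
  Perron--Frobenius eigenvalue \<open>\<beta>\<close>, because the characteristic polynomial is irreducible, and differ
  from \<open>\<beta>\<close>, because the \<open>\<beta>\<close>-eigenvectors are multiples of \<open>R\<close>; so they have modulus less than \<open>1\<close>.
\<close>


section \<open>Evaluating integer characteristic polynomials\<close>

lemma poly_map_of_int_add:
  "poly (map_poly of_int (p + q)) x
     = poly (map_poly of_int p) x + poly (map_poly of_int q) (x :: 'b::comm_ring_1)"
  by (induction p q rule: poly_induct2) (auto simp: map_poly_pCons algebra_simps)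

lemma poly_map_of_int_smult:
  "poly (map_poly of_int (smult c p)) x
     = of_int c * poly (map_poly of_int p) (x :: 'b::comm_ring_1)"
  by (induction p) (auto simp: map_poly_pCons algebra_simps)

lemma poly_map_of_int_mult:
  "poly (map_poly of_int (p * q)) x
     = poly (map_poly of_int p) x * poly (map_poly of_int q) (x :: 'b::comm_ring_1)"
  by (induction p)
     (auto simp: map_poly_pCons algebra_simps poly_map_of_int_add poly_map_of_int_smult)

lemma poly_map_of_int_sum:
  "poly (map_poly of_int (sum f S)) x
     = (\<Sum>i\<in>S. poly (map_poly of_int (f i)) (x :: 'b::comm_ring_1))"
  by (induction S rule: infinite_finite_induct) (auto simp: poly_map_of_int_add)

lemma poly_map_of_int_prod:
  "poly (map_poly of_int (prod f S)) x
     = (\<Prod>i\<in>S. poly (map_poly of_int (f i)) (x :: 'b::comm_ring_1))"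
  by (induction S rule: infinite_finite_induct) (auto simp: poly_map_of_int_mult)

lemma poly_map_of_int_of_int:
  "poly (map_poly of_int (of_int c)) x = (of_int c :: 'b::comm_ring_1)"
  by (simp add: of_int_poly map_poly_pCons)

lemma poly_map_of_int_det:
  fixes A :: "int poly ^ 'n ^ 'n" and x :: "'b::comm_ring_1"
  shows "poly (map_poly of_int (det A)) x = det (\<chi> i j. poly (map_poly of_int (A $ i $ j)) x)"
  by (simp add: det_def poly_map_of_int_sum poly_map_of_int_mult poly_map_of_int_prod
      poly_map_of_int_of_int)

text \<open>
  Stated over an arbitrary field because it is needed twice for the same integer matrix: over the
  reals for the Perron--Frobenius eigenvalue and over the complex numbers for the other ones.
\<close>

lemma eigenvalue_root_of_charpoly:
  fixes A :: "int ^ 'n ^ 'n" and \<mu> :: "'b::field"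
  assumes ev: "(\<chi> i j. of_int (A $ i $ j)) *v v = \<mu> *s v" and "v \<noteq> 0"
  shows "poly (map_poly of_int (charpoly A)) \<mu> = 0"
proof -
  let ?A = "(\<chi> i j. of_int (A $ i $ j)) :: 'b ^ 'n ^ 'n"
  have "mat \<mu> *v v = \<mu> *s v"
    by (simp add: vec_eq_iff matrix_vector_mult_def mat_def if_distribR if_distrib cong: if_cong)
  hence "(mat \<mu> - ?A) *v v = 0"
    using ev by (simp add: matrix_vector_mult_diff_rdistrib)
  hence "\<not> invertible (mat \<mu> - ?A)"
    using \<open>v \<noteq> 0\<close> matrix_left_invertible_ker[of "mat \<mu> - ?A"] by (auto simp: invertible_def)
  hence "det (mat \<mu> - ?A) = 0"
    by (simp add: invertible_det_nz)
  moreover have "(\<chi> i j. poly (map_poly of_int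
      ((mat [:0, 1:] - (\<chi> i j. [:A $ i $ j:])) $ i $ j)) \<mu>) = mat \<mu> - ?A"
    by (simp add: vec_eq_iff mat_def map_poly_pCons)
  ultimately show ?thesis
    by (simp add: charpoly_def poly_map_of_int_det)
qed

section \<open>Summable orbits of linear maps\<close>

text \<open>
  This is \<open>p(M) h\<close>, evaluated by Horner's rule so that it obeys a recursion along \<open>pCons\<close>.
\<close>

definition poly_act :: "complex poly \<Rightarrow> complex ^ 'n ^ 'n \<Rightarrow> complex ^ 'n \<Rightarrow> complex ^ 'n" where
  "poly_act p M h = fold_coeffs (\<lambda>a y. a *s h + M *v y) p 0"

lemma poly_act_0 [simp]: "poly_act 0 M h = 0"
  by (simp add: poly_act_def)

lemma poly_act_pCons [simp]: "poly_act (pCons a p) M h = a *s h + M *v poly_act p M h"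
  by (cases "p = 0"; cases "a = 0") (auto simp: poly_act_def)

lemma poly_act_add: "poly_act (p + q) M h = poly_act p M h + poly_act q M h"
  by (induction p q rule: poly_induct2)
     (auto simp: algebra_simps matrix_vector_right_distrib vector_sadd_rdistrib)

lemma poly_act_smult: "poly_act (smult c p) M h = c *s poly_act p M h"
  by (induction p)
     (auto simp: vector_add_ldistrib vector_smult_assoc vector_scalar_commute)

lemma poly_act_diff_arg: "poly_act p M (g - h) = poly_act p M g - poly_act p M h"
  by (induction p) (auto simp: vector_ssub_ldistrib matrix_vector_mult_diff_distrib)

lemma poly_act_smult_arg: "poly_act p M (c *s h) = c *s poly_act p M h"
  by (induction p)
     (auto simp: vector_add_ldistrib vector_smult_assoc vector_scalar_commute mult.commute)

lemma poly_act_commute: "poly_act p M (M *v h) = M *v poly_act p M h"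
  by (induction p) (auto simp: matrix_vector_right_distrib vector_scalar_commute)

lemma poly_act_linear_factor:
  "poly_act ([:-\<mu>, 1:] * q) M h = M *v poly_act q M h - \<mu> *s poly_act q M h"
proof -
  have "[:-\<mu>, 1:] * q = smult (-\<mu>) q + pCons 0 q"
    by simp
  hence "poly_act ([:-\<mu>, 1:] * q) M h = (-\<mu>) *s poly_act q M h + M *v poly_act q M h"
    by (simp only: poly_act_add poly_act_smult poly_act_pCons) simp
  thus ?thesis
    by (simp add: vec_eq_iff)
qed

lemma poly_act_monom: "poly_act (monom c n) M h = c *s (((*v) M) ^^ n) h"
  by (induction n) (auto simp: monom_0 monom_Suc vector_scalar_commute)

lemma poly_act_sum: "poly_act (sum f S) M h = (\<Sum>i\<in>S. poly_act (f i) M h)"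
  by (induction S rule: infinite_finite_induct) (auto simp: poly_act_add)

lemma poly_act_in_subspace:
  assumes "vec.subspace H" "\<And>h. h \<in> H \<Longrightarrow> M *v h \<in> H" "h \<in> H"
  shows "poly_act p M h \<in> H"
  by (induction p) (auto intro!: assms vec.subspace_add vec.subspace_scale vec.subspace_0)

text \<open>
  A sequence rather than a set, so that repeated terms count as a dependency: this is what turns
  the first few vectors of any orbit, possibly a periodic one, into an annihilating polynomial.
\<close>

lemma linearly_dependent_sequence:
  fixes f :: "nat \<Rightarrow> 'v::euclidean_space"
  shows "\<exists>c. (\<exists>i\<le>DIM('v). c i \<noteq> 0) \<and> (\<Sum>i\<le>DIM('v). c i *\<^sub>R f i) = 0"
proof (cases "inj_on f {..DIM('v)}")
  case True
  hence "card (f ` {..DIM('v)}) > DIM('v)"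
    by (simp add: card_image)
  hence "dependent (f ` {..DIM('v)})"
    by (intro dependent_biggerset) auto
  then obtain u where u: "\<exists>v\<in>f ` {..DIM('v)}. u v \<noteq> 0"
      "(\<Sum>v\<in>f ` {..DIM('v)}. u v *\<^sub>R v) = 0"
    by (subst (asm) real_vector.dependent_finite) auto
  from u(2) have "(\<Sum>i\<le>DIM('v). u (f i) *\<^sub>R f i) = 0"
    by (subst (asm) sum.reindex[OF True]) simp
  thus ?thesis
    using u(1) by (intro exI[of _ "\<lambda>i. u (f i)"]) auto
next
  case False
  then obtain i j where ij: "i \<le> DIM('v)" "j \<le> DIM('v)" "i \<noteq> j" "f i = f j"
    by (auto simp: inj_on_def)
  define c where "c k = (if k = i then 1 else if k = j then -1 else (0::real))" for k
  have "(\<Sum>k\<le>DIM('v). c k *\<^sub>R f k) = (\<Sum>k\<in>{i, j}. c k *\<^sub>R f k)"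
    using ij by (intro sum.mono_neutral_right) (auto simp: c_def)
  also have "\<dots> = 0"
    using ij by (simp add: c_def)
  finally show ?thesis
    using ij by (intro exI[of _ c]) (auto simp: c_def)
qed

lemma exists_annihilating_poly:
  fixes M :: "complex ^ 'n ^ 'n"
  shows "\<exists>p. p \<noteq> 0 \<and> poly_act p M h = 0"
proof -
  let ?D = "DIM(complex ^ 'n)"
  obtain c where c: "\<exists>i\<le>?D. c i \<noteq> 0" "(\<Sum>i\<le>?D. c i *\<^sub>R ((*v) M ^^ i) h) = 0"
    using linearly_dependent_sequence[of "\<lambda>i. ((*v) M ^^ i) h"] by blast
  define p where "p = (\<Sum>i\<le>?D. monom (complex_of_real (c i)) i)"
  have "coeff p i = complex_of_real (c i)" if "i \<le> ?D" for i
    using that by (simp add: p_def coeff_sum if_distrib cong: if_cong)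
  with c(1) have "p \<noteq> 0"
    by force
  moreover have "complex_of_real r *s x = r *\<^sub>R x" for r and x :: "complex ^ 'n"
    by (simp add: vec_eq_iff scaleR_conv_of_real[symmetric])
  hence "poly_act p M h = 0"
    using c(2) by (simp add: p_def poly_act_sum poly_act_monom)
  ultimately show ?thesis by blast
qed

lemma norm_complex_smult: "norm (c *s (x :: complex ^ 'n)) = cmod c * norm x"
  by (simp add: norm_vec_def norm_mult L2_set_right_distrib)

text \<open>
  Summing the recursion bounds every partial sum \<open>A\<close> of \<open>a\<close> by \<open>a\<^sub>0 + r A + \<Sum>e\<close>, and \<open>r < 1\<close>
  allows one to solve for \<open>A\<close>.
\<close>

lemma summable_of_affine_contraction:
  fixes a e :: "nat \<Rightarrow> real"
  assumes a: "\<And>n. 0 \<le> a n" and r: "0 \<le> r" "r < 1"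
    and step: "\<And>n. a (Suc n) \<le> r * a n + e n" and e: "summable e" "\<And>n. 0 \<le> e n"
  shows "summable a"
proof (rule bounded_imp_summable)
  fix n
  have "(\<Sum>k\<le>n. a k) \<le> a 0 + (\<Sum>k<n. a (Suc k))"
    by (metis lessThan_Suc_atMost sum.lessThan_Suc_shift order_refl)
  also have "(\<Sum>k<n. a (Suc k)) \<le> (\<Sum>k<n. r * a k + e k)"
    by (intro sum_mono step)
  also have "\<dots> = r * (\<Sum>k<n. a k) + (\<Sum>k<n. e k)"
    by (simp add: sum.distrib sum_distrib_left)
  also have "\<dots> \<le> r * (\<Sum>k\<le>n. a k) + suminf e"
    by (intro add_mono mult_left_mono sum_mono2 sum_le_suminf) (auto simp: a e r)
  finally show "(\<Sum>k\<le>n. a k) \<le> (a 0 + suminf e) / (1 - r)"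
    using r by (simp add: field_simps)
qed (rule a)

text \<open>
  Induction on the annihilating polynomial \<open>p = (x - \<mu>) q\<close>.  The vector \<open>g = q(M) h\<close> is killed by
  \<open>M - \<mu>\<close>, so either \<open>g = 0\<close> and \<open>q\<close> already annihilates \<open>h\<close>, or \<open>\<mu>\<close> is an eigenvalue on \<open>H\<close> and
  \<open>|\<mu>| < 1\<close>.  In the second case \<open>q\<close> annihilates \<open>h' = (M - \<mu>) h\<close>, and the orbit of \<open>h\<close> arises from
  the summable orbit of \<open>h'\<close> by a contracting affine recursion.  Summability, unlike a geometric
  rate, is inherited unchanged when a root is repeated.
\<close>

lemma summable_orbit_if_annihilated:
  fixes M :: "complex ^ 'n ^ 'n"
  assumes H: "vec.subspace H" "\<And>h. h \<in> H \<Longrightarrow> M *v h \<in> H"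
    and ev: "\<And>\<mu> g. g \<in> H \<Longrightarrow> g \<noteq> 0 \<Longrightarrow> M *v g = \<mu> *s g \<Longrightarrow> cmod \<mu> < 1"
    and p: "p \<noteq> 0" "poly_act p M h = 0" and h: "h \<in> H"
  shows "summable (\<lambda>n. norm (((*v) M ^^ n) h))"
  using p h
proof (induction "degree p" arbitrary: p h)
  case 0
  then obtain c where "p = [:c:]" "c \<noteq> 0"
    by (metis degree_eq_zeroE pCons_eq_0_iff)
  with 0 have "h = 0" by simp
  moreover have "((*v) M ^^ n) 0 = 0" for n
    by (induction n) auto
  ultimately show ?case by simp
next
  case (Suc k)
  have "\<not> constant (poly p)"
    using Suc.hyps(2) by (simp add: constant_degree)
  then obtain \<mu> where "poly p \<mu> = 0"
    using fundamental_theorem_of_algebra by blast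
  then obtain q where q: "p = [:-\<mu>, 1:] * q"
    by (auto simp: poly_eq_0_iff_dvd)
  have "q \<noteq> 0" using q Suc.prems(1) by auto
  have "degree p = Suc (degree q)"
    unfolding q using \<open>q \<noteq> 0\<close> by (subst degree_mult_eq) auto
  hence deg: "k = degree q"
    using Suc.hyps(2) by simp
  define g where "g = poly_act q M h"
  have Mg: "M *v g = \<mu> *s g"
    using Suc.prems(2) by (simp only: q poly_act_linear_factor g_def eq_iff_diff_eq_0[symmetric])
  show ?case
  proof (cases "g = 0")
    case True
    thus ?thesis
      using Suc.hyps(1)[OF deg \<open>q \<noteq> 0\<close>] Suc.prems(3) by (simp add: g_def)
  next
    case False
    have "g \<in> H"
      unfolding g_def by (intro poly_act_in_subspace H Suc.prems)
    hence \<mu>: "cmod \<mu> < 1"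
      using ev False Mg by blast
    define h' where "h' = M *v h - \<mu> *s h"
    have "h' \<in> H"
      unfolding h'_def by (intro vec.subspace_diff vec.subspace_scale H Suc.prems)
    moreover have "poly_act q M h' = 0"
      using Mg by (simp add: h'_def poly_act_diff_arg poly_act_smult_arg poly_act_commute g_def)
    ultimately have e: "summable (\<lambda>n. norm (((*v) M ^^ n) h'))"
      using Suc.hyps(1)[OF deg \<open>q \<noteq> 0\<close>] by blast
    have eq: "((*v) M ^^ n) h' = ((*v) M ^^ Suc n) h - \<mu> *s ((*v) M ^^ n) h" for n
      by (induction n)
         (auto simp: h'_def matrix_vector_mult_diff_distrib vector_scalar_commute)
    have "norm (((*v) M ^^ Suc n) h) \<le>
        cmod \<mu> * norm (((*v) M ^^ n) h) + norm (((*v) M ^^ n) h')" for n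
      unfolding norm_complex_smult[symmetric] eq
      by (rule norm_triangle_sub)
    from summable_of_affine_contraction[OF _ _ \<mu> this e] show ?thesis
      by simp
  qed
qed

section \<open>Perron--Frobenius eigenvectors of primitive matrices\<close>

lemma primitive_matrix_power_vec:
  fixes M :: "real ^ 'n ^ 'n"
  shows "((\<lambda>A. M ** A) ^^ k) (mat 1) *v x = ((*v) M ^^ k) (x :: real ^ 'n)"
  by (induction k) (auto simp: matrix_vector_mul_assoc[symmetric])

lemma funpow_eigenvector:
  fixes M :: "real ^ 'n ^ 'n"
  shows "M *v z = r *s z \<Longrightarrow> ((*v) M ^^ k) z = r ^ k *s z"
  by (induction k) (auto simp: vector_scalar_commute vector_smult_assoc mult.commute)

text \<open>
  Take the least \<open>t\<close> with \<open>y \<le> t R\<close>.  The eigenvector \<open>z = t R - y\<close> is then nonnegative and has a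
  vanishing coordinate; a strictly positive power of \<open>M\<close> maps it to a multiple of itself, which
  forces all its coordinates to vanish.
\<close>

lemma primitive_eigenvector_unique:
  fixes M :: "real ^ 'n ^ 'n" and R y :: "real ^ 'n"
  assumes "primitive_matrix M"
    and R: "\<And>i. R $ i > 0" "M *v R = r *s R"
    and y: "M *v y = r *s y"
  shows "\<exists>t. y = t *s R"
proof -
  define t where "t = Max (range (\<lambda>i. y $ i / R $ i))"
  have "t \<in> range (\<lambda>i. y $ i / R $ i)"
    unfolding t_def by (intro Max_in) auto
  then obtain i where i: "t = y $ i / R $ i" by auto
  define z where "z = t *s R - y"
  have z0: "0 \<le> z $ j" for j
  proof -
    have "y $ j / R $ j \<le> t"
      unfolding t_def by (intro Max_ge) auto
    thus ?thesis
      using R(1)[of j] by (simp add: z_def field_simps)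
  qed
  have zi: "z $ i = 0"
    using R(1)[of i] by (simp add: z_def i)
  have Mz: "M *v z = r *s z"
    by (simp add: z_def matrix_vector_mult_diff_distrib vector_scalar_commute R(2) y
        vector_ssub_ldistrib vector_smult_assoc mult.commute)
  obtain k where k: "\<And>i j. ((\<lambda>A. M ** A) ^^ k) (mat 1) $ i $ j > 0"
    using assms(1) by (auto simp: primitive_matrix_def)
  let ?P = "((\<lambda>A. M ** A) ^^ k) (mat 1)"
  have "(?P *v z) $ i = 0"
    by (simp add: primitive_matrix_power_vec funpow_eigenvector[OF Mz] zi)
  hence sum0: "(\<Sum>j\<in>UNIV. ?P $ i $ j * z $ j) = 0"
    by (simp add: matrix_vector_mult_def)
  have "?P $ i $ j * z $ j = 0" for j
    using k z0 sum0
    by (subst (asm) sum_nonneg_eq_0_iff) (auto intro: mult_nonneg_nonneg less_imp_le)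
  hence "z $ j = 0" for j
    using k[of i j] by (metis less_irrefl mult_eq_0_iff)
  thus ?thesis
    by (intro exI[of _ t]) (simp add: z_def vec_eq_iff)
qed

section \<open>Contraction along the Perron--Frobenius direction\<close>

locale pisot_random_subst =
  fixes \<theta> :: "'a::finite \<Rightarrow> 'a list set" and L R :: "real ^ 'a"
  assumes random: "random_subst \<theta>"
    and compat: "compatible \<theta>"
    and pisot: "irreducible_pisot \<theta>"
    and right_pf: "right_pf_eigenvector (subst_matrix \<theta>) R"
    and left_pf: "left_pf_eigenvector (subst_matrix \<theta>) L"
    and normalised: "L \<bullet> R = 1"
begin

abbreviation M :: "real ^ 'a ^ 'a" where
  "M \<equiv> subst_matrix \<theta>"

abbreviation M_pow :: "nat \<Rightarrow> real ^ 'a \<Rightarrow> real ^ 'a" where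
  "M_pow n \<equiv> (*v) M ^^ n"

abbreviation \<beta> :: real where
  "\<beta> \<equiv> pf_eigenvalue M"

abbreviation \<pi> :: "real ^ 'a \<Rightarrow> real ^ 'a" where
  "\<pi> \<equiv> pf_proj L R"

lemma primitive: "primitive_matrix M" and \<beta>_gt_1: "\<beta> > 1"
  using pisot by (auto simp: irreducible_pisot_def primitive_subst_def)

lemma R_pos: "R $ i > 0" and MR: "M *v R = \<beta> *s R"
  using right_pf by (auto simp: right_pf_eigenvector_def)

lemma L_pos: "L $ i > 0" and LM: "L v* M = \<beta> *s L"
  using left_pf by (auto simp: left_pf_eigenvector_def)

lemma L_inner_M: "L \<bullet> (M *v x) = \<beta> * (L \<bullet> x)"
proof -
  have "L \<bullet> (M *v x) = (L v* M) \<bullet> x"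
    by (rule dot_lmul_matrix[symmetric])
  thus ?thesis
    by (simp only: LM) (simp add: inner_vec_def sum_distrib_left mult.assoc)
qed

lemma L_inner_M_pow: "L \<bullet> M_pow n x = \<beta> ^ n * (L \<bullet> x)"
  by (induction n) (auto simp: L_inner_M)

lemma eigenvector_in_hyperplane:
  assumes "M *v y = \<beta> *s y" "L \<bullet> y = 0"
  shows "y = 0"
proof -
  obtain t where t: "y = t *s R"
    using primitive_eigenvector_unique[OF primitive R_pos MR assms(1)] by blast
  have "t *s R = t *\<^sub>R R"
    by (simp add: vec_eq_iff)
  hence "L \<bullet> y = t"
    using normalised by (simp add: t)
  with t assms(2) show ?thesis by simp
qed

abbreviation M_complex :: "complex ^ 'a ^ 'a" where
  "M_complex \<equiv> subst_matrix \<theta>"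

lemma M_complex_nth: "M_complex $ i $ j = complex_of_real (M $ i $ j)"
  by (simp add: subst_matrix_def)

lemma M_of_int:
  "(\<chi> i j. of_int (subst_matrix \<theta> $ i $ j)) = (subst_matrix \<theta> :: 'b::comm_ring_1 ^ 'a ^ 'a)"
  by (simp add: subst_matrix_def vec_eq_iff)

definition complex_hyperplane :: "(complex ^ 'a) set" where
  "complex_hyperplane = {h. (\<Sum>i\<in>UNIV. complex_of_real (L $ i) * h $ i) = 0}"

lemma subspace_complex_hyperplane: "vec.subspace complex_hyperplane"
  unfolding vec.subspace_def complex_hyperplane_def
  by (auto simp: algebra_simps sum.distrib simp flip: sum_distrib_left)

lemma complex_hyperplane_invariant:
  assumes "h \<in> complex_hyperplane"
  shows "M_complex *v h \<in> complex_hyperplane"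
proof -
  have LMj: "(\<Sum>i\<in>UNIV. complex_of_real (L $ i) * M_complex $ i $ j) = \<beta> * complex_of_real (L $ j)"
    for j
  proof -
    have "(\<Sum>i\<in>UNIV. L $ i * M $ i $ j) = \<beta> * L $ j"
      using arg_cong[OF LM, of "\<lambda>v. v $ j"]
      by (simp add: vector_matrix_mult_def mult.commute)
    thus ?thesis
      unfolding M_complex_nth by (metis (mono_tags, lifting) of_real_mult of_real_sum sum.cong)
  qed
  have "(\<Sum>i\<in>UNIV. complex_of_real (L $ i) * (M_complex *v h) $ i)
      = (\<Sum>i\<in>UNIV. \<Sum>j\<in>UNIV. complex_of_real (L $ i) * M_complex $ i $ j * h $ j)"
    by (simp add: matrix_vector_mult_def sum_distrib_left mult.assoc)
  also have "\<dots> = (\<Sum>j\<in>UNIV. (\<Sum>i\<in>UNIV. complex_of_real (L $ i) * M_complex $ i $ j) * h $ j)"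
    by (subst sum.swap) (simp add: sum_distrib_right)
  also have "\<dots> = \<beta> * (\<Sum>j\<in>UNIV. complex_of_real (L $ j) * h $ j)"
    by (simp add: LMj sum_distrib_left mult.assoc)
  finally show ?thesis
    using assms by (simp add: complex_hyperplane_def)
qed

lemma \<beta>_eigenvector_in_complex_hyperplane:
  assumes g: "g \<in> complex_hyperplane" and Mg: "M_complex *v g = complex_of_real \<beta> *s g"
  shows "g = 0"
proof -
  define y1 y2 where "y1 = (\<chi> i. Re (g $ i))" and "y2 = (\<chi> i. Im (g $ i))"
  have eq: "(\<Sum>j\<in>UNIV. complex_of_real (M $ i $ j) * g $ j) = complex_of_real \<beta> * g $ i" for i
    using arg_cong[OF Mg, of "\<lambda>v. v $ i"] by (simp add: matrix_vector_mult_def M_complex_nth)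
  have "M *v y1 = \<beta> *s y1" "M *v y2 = \<beta> *s y2"
    using arg_cong[OF eq, of Re] arg_cong[OF eq, of Im]
    by (simp_all add: vec_eq_iff matrix_vector_mult_def y1_def y2_def)
  moreover have "L \<bullet> y1 = 0" "L \<bullet> y2 = 0"
    using arg_cong[of _ _ Re, OF g[unfolded complex_hyperplane_def mem_Collect_eq]]
      arg_cong[of _ _ Im, OF g[unfolded complex_hyperplane_def mem_Collect_eq]]
    by (simp_all add: inner_vec_def y1_def y2_def)
  ultimately have "y1 = 0" "y2 = 0"
    using eigenvector_in_hyperplane by blast+
  thus ?thesis
    by (simp add: y1_def y2_def vec_eq_iff complex_eq_iff)
qed

text \<open>
  The integer characteristic polynomial is irreducible and vanishes at both \<open>\<beta>\<close> and \<open>\<mu>\<close>, so they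
  are Galois conjugates.  The Pisot property bounds every conjugate other than \<open>\<beta>\<close> itself, and
  \<open>\<beta>\<close> has no eigenvector orthogonal to \<open>L\<close>.
\<close>

lemma eigenvalue_in_complex_hyperplane:
  assumes "g \<in> complex_hyperplane" "g \<noteq> 0" "M_complex *v g = \<mu> *s g"
  shows "cmod \<mu> < 1"
proof -
  let ?\<chi> = "charpoly (subst_matrix \<theta> :: int ^ 'a ^ 'a)"
  have "R \<noteq> 0"
    using R_pos by (metis less_irrefl zero_index)
  hence "poly (map_poly of_int ?\<chi>) \<beta> = 0"
    by (intro eigenvalue_root_of_charpoly[of _ R]) (auto simp: M_of_int MR)
  moreover have "poly (map_poly of_int ?\<chi>) \<mu> = 0"
    using assms by (intro eigenvalue_root_of_charpoly[of _ g]) (auto simp: M_of_int)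
  ultimately have "\<mu> \<in> galois_conjugates \<beta>"
    using pisot by (auto simp: galois_conjugates_def irreducible_pisot_def)
  moreover have "\<mu> \<noteq> complex_of_real \<beta>"
    using \<beta>_eigenvector_in_complex_hyperplane assms by blast
  ultimately show ?thesis
    using pisot by (auto simp: irreducible_pisot_def pisot_number_def)
qed

lemma summable_M_pow_hyperplane:
  assumes "L \<bullet> h = 0"
  shows "summable (\<lambda>n. norm (M_pow n h))"
proof -
  \<comment> \<open>\<open>c\<close> is the isometric embedding of the real vectors, compatible with the two matrices.\<close>
  define c :: "real ^ 'a \<Rightarrow> complex ^ 'a" where "c x = (\<chi> i. complex_of_real (x $ i))" for x
  have cM: "M_complex *v c x = c (M *v x)" for x
    by (simp add: vec_eq_iff c_def matrix_vector_mult_def M_complex_nth)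
  have pow: "((*v) M_complex ^^ n) (c x) = c (M_pow n x)" for n x
    by (induction n) (auto simp: cM)
  have norm_c: "norm (c x) = norm x" for x
    by (simp add: norm_vec_def c_def)
  have "(\<Sum>i\<in>UNIV. complex_of_real (L $ i) * c h $ i) = complex_of_real (L \<bullet> h)"
    by (simp add: c_def inner_vec_def)
  hence ch: "c h \<in> complex_hyperplane"
    using assms by (simp add: complex_hyperplane_def)
  obtain p where p: "p \<noteq> 0" "poly_act p M_complex (c h) = 0"
    using exists_annihilating_poly by blast
  have "summable (\<lambda>n. norm (((*v) M_complex ^^ n) (c h)))"
    by (rule summable_orbit_if_annihilated[OF subspace_complex_hyperplane
          complex_hyperplane_invariant eigenvalue_in_complex_hyperplane p ch])
  thus ?thesis
    by (simp add: pow norm_c)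
qed

lemma \<pi>_eq: "\<pi> x = x - (L \<bullet> x) *\<^sub>R R"
  by (rule pf_proj_eq[OF normalised])

lemma \<pi>_add: "\<pi> (x + y) = \<pi> x + \<pi> y"
  by (simp add: \<pi>_eq inner_add_right algebra_simps)

lemma \<pi>_M_pow: "\<pi> (M_pow n x) = M_pow n (\<pi> x)"
proof (induction n)
  case (Suc n)
  have "M *v (c *\<^sub>R R) = c *\<^sub>R (\<beta> *\<^sub>R R)" for c
    using MR by (simp add: scalar_mult_eq_scaleR matrix_vector_mult_scaleR)
  hence "\<pi> (M *v x) = M *v \<pi> x" for x
    by (simp add: \<pi>_eq matrix_vector_mult_diff_distrib L_inner_M mult.commute)
  thus ?case
    using Suc by simp
qed simp

text \<open>
  The contraction that the combinatorics of prefixes relies on: it bounds the positions of all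
  prefixes, and it makes the position of an inflated word tend to \<open>0\<close> as the level grows.
\<close>

lemma summable_\<pi>_M_pow: "summable (\<lambda>n. norm (\<pi> (M_pow n x)))"
  unfolding \<pi>_M_pow
  by (rule summable_M_pow_hyperplane) (simp add: \<pi>_eq inner_diff_right normalised)

end

section \<open>Words under an iterated random substitution\<close>

lemma subst_word_Nil [simp]: "subst_word \<theta> [] = {[]}"
  by (auto simp: subst_word_def)

lemma subst_word_append:
  "subst_word \<theta> (u @ v) = {x @ y |x y. x \<in> subst_word \<theta> u \<and> y \<in> subst_word \<theta> v}"
proof safe
  fix z assume "z \<in> subst_word \<theta> (u @ v)"
  then obtain vs where vs: "z = concat vs" "list_all2 (\<lambda>v a. v \<in> \<theta> a) vs (u @ v)"
    by (auto simp: subst_word_def)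
  then obtain xs ys where "vs = xs @ ys" "list_all2 (\<lambda>v a. v \<in> \<theta> a) xs u"
      "list_all2 (\<lambda>v a. v \<in> \<theta> a) ys v"
    by (auto simp: list_all2_append2)
  thus "\<exists>x y. z = x @ y \<and> x \<in> subst_word \<theta> u \<and> y \<in> subst_word \<theta> v"
    unfolding vs(1) subst_word_def by (intro exI[of _ "concat xs"] exI[of _ "concat ys"]) auto
next
  fix x y assume "x \<in> subst_word \<theta> u" "y \<in> subst_word \<theta> v"
  then obtain xs ys where "x = concat xs" "list_all2 (\<lambda>v a. v \<in> \<theta> a) xs u"
      "y = concat ys" "list_all2 (\<lambda>v a. v \<in> \<theta> a) ys v"
    by (auto simp: subst_word_def)
  thus "x @ y \<in> subst_word \<theta> (u @ v)"
    unfolding subst_word_def by (auto intro!: exI[of _ "xs @ ys"] list_all2_appendI)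
qed

lemma subst_word_singleton [simp]: "subst_word \<theta> [a] = \<theta> a"
proof -
  have "x \<in> subst_word \<theta> [a]" if "x \<in> \<theta> a" for x
    using that unfolding subst_word_def by (auto intro!: exI[of _ "[x]"])
  thus ?thesis
    by (auto simp: subst_word_def list_all2_Cons2)
qed

lemma subst_word_Cons:
  "subst_word \<theta> (a # u) = {x @ y |x y. x \<in> \<theta> a \<and> y \<in> subst_word \<theta> u}"
  using subst_word_append[of \<theta> "[a]" u] by simp

lemma subst_iter_0 [simp]: "subst_iter \<theta> 0 u = {u}"
  by (simp add: subst_iter_def)

lemma subst_iter_Suc: "subst_iter \<theta> (Suc n) u = (\<Union>v\<in>subst_iter \<theta> n u. subst_word \<theta> v)"
  by (simp add: subst_iter_def subst_lang_def)

lemma subst_iter_add: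
  "subst_iter \<theta> (m + n) u = (\<Union>v\<in>subst_iter \<theta> m u. subst_iter \<theta> n v)"
  by (induction n) (auto simp: subst_iter_Suc)

lemma subst_iter_addI:
  "v \<in> subst_iter \<theta> m u \<Longrightarrow> x \<in> subst_iter \<theta> n v \<Longrightarrow> x \<in> subst_iter \<theta> (m + n) u"
  by (auto simp: subst_iter_add)

lemma subst_iter_append:
  "z \<in> subst_iter \<theta> n (u @ v) \<longleftrightarrow>
     (\<exists>x y. z = x @ y \<and> x \<in> subst_iter \<theta> n u \<and> y \<in> subst_iter \<theta> n v)"
proof (induction n arbitrary: z)
  case (Suc n)
  have "z \<in> subst_iter \<theta> (Suc n) (u @ v) \<longleftrightarrow>
      (\<exists>x y. x \<in> subst_iter \<theta> n u \<and> y \<in> subst_iter \<theta> n v \<and> z \<in> subst_word \<theta> (x @ y))"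
    unfolding subst_iter_Suc UN_iff Bex_def Suc.IH by blast
  also have "\<dots> \<longleftrightarrow>
      (\<exists>x y. z = x @ y \<and> x \<in> subst_iter \<theta> (Suc n) u \<and> y \<in> subst_iter \<theta> (Suc n) v)"
    unfolding subst_iter_Suc subst_word_append by blast
  finally show ?case .
qed auto

lemma subst_iter_appendI:
  "x \<in> subst_iter \<theta> n u \<Longrightarrow> y \<in> subst_iter \<theta> n v \<Longrightarrow> x @ y \<in> subst_iter \<theta> n (u @ v)"
  by (auto simp: subst_iter_append)

lemma subst_iter_ConsI:
  "x \<in> subst_iter \<theta> n [a] \<Longrightarrow> y \<in> subst_iter \<theta> n u \<Longrightarrow> x @ y \<in> subst_iter \<theta> n (a # u)"
  using subst_iter_appendI[of x \<theta> n "[a]" y u] by simp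

lemma subst_iter_ConsE:
  assumes "z \<in> subst_iter \<theta> n (a # u)"
  obtains x y where "z = x @ y" "x \<in> subst_iter \<theta> n [a]" "y \<in> subst_iter \<theta> n u"
  using assms subst_iter_append[of z \<theta> n "[a]" u] by auto

lemma subst_iter_Nil [simp]: "subst_iter \<theta> n [] = {[]}"
  by (induction n) (auto simp: subst_iter_Suc)

lemma subst_iter_concat_map:
  "(\<And>a. a \<in> set u \<Longrightarrow> f a \<in> subst_iter \<theta> n [a]) \<Longrightarrow> concat (map f u) \<in> subst_iter \<theta> n u"
  by (induction u) (auto intro!: subst_iter_ConsI)

lemma subst_iter_nonempty:
  assumes "random_subst \<theta>"
  shows "subst_iter \<theta> n u \<noteq> {}"
proof -
  have "subst_iter \<theta> n [a] \<noteq> {}" for a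
  proof (induction n)
    case (Suc n)
    then obtain v where v: "v \<in> subst_iter \<theta> n [a]" by blast
    have "subst_word \<theta> v \<noteq> {}"
      using assms by (induction v) 
        (auto simp: random_subst_def subst_word_Cons)
    with v show ?case by (auto simp: subst_iter_Suc)
  qed auto
  hence single: "\<exists>x. x \<in> subst_iter \<theta> n [a]" for a
    by blast
  have "\<exists>y. y \<in> subst_iter \<theta> n u"
  proof (induction u)
    case (Cons a u)
    then obtain y where "y \<in> subst_iter \<theta> n u" by blast
    moreover obtain x where "x \<in> subst_iter \<theta> n [a]"
      using single by blast
    ultimately show ?case
      by (blast intro: subst_iter_ConsI)
  qed simp
  thus ?thesis by blast
qed

lemma subst_iter_not_Nil:
  assumes "random_subst \<theta>" "u \<noteq> []" "x \<in> subst_iter \<theta> n u"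
  shows "x \<noteq> []"
proof -
  have *: "subst_word \<theta> v \<subseteq> - {[]}" if "v \<noteq> []" for v
    using that assms(1)
    by (cases v) (auto simp: random_subst_def subst_word_Cons)
  show ?thesis
    using assms(3)
  proof (induction n arbitrary: x)
    case (Suc n)
    then show ?case using * by (fastforce simp: subst_iter_Suc)
  qed (use assms(2) in auto)
qed

text \<open>
  A prefix of an inflated word cuts exactly one inflated letter.  Applied level by level, this is
  the Dumont--Thomas expansion of a prefix.
\<close>

lemma prefix_subst_iterE:
  assumes "x \<in> subst_iter \<theta> n u" "prefix v x" "u \<noteq> []"
  obtains u1 c u2 y z z' where "u = u1 @ c # u2" "v = y @ z" "y \<in> subst_iter \<theta> n u1"
    "z' \<in> subst_iter \<theta> n [c]" "prefix z z'"
  using assms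
proof (induction u arbitrary: x v thesis)
  case (Cons c u)
  from Cons.prems(2) obtain x1 x2 where x: "x = x1 @ x2" "x1 \<in> subst_iter \<theta> n [c]"
      "x2 \<in> subst_iter \<theta> n u"
    by (rule subst_iter_ConsE)
  show ?case
  proof (cases "prefix v x1")
    case True
    thus ?thesis
      using x(2) by (intro Cons.prems(1)[of "[]" c u "[]" v x1]) auto
  next
    case False
    then obtain v' where v': "v = x1 @ v'" "prefix v' x2"
      using Cons.prems(3) x(1) by (auto simp: prefix_append)
    have "u \<noteq> []"
      using False v' x(3) by auto
    then obtain u1 d u2 y z z' where d: "u = u1 @ d # u2" "v' = y @ z" "y \<in> subst_iter \<theta> n u1"
        "z' \<in> subst_iter \<theta> n [d]" "prefix z z'"
      using Cons.IH[OF _ x(3) v'(2)] by blast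
    have "x1 @ y \<in> subst_iter \<theta> n (c # u1)"
      using x(2) d(3) by (rule subst_iter_ConsI)
    thus ?thesis
      using d v'(1) by (intro Cons.prems(1)[of "c # u1" d u2 "x1 @ y" z z']) auto
  qed
qed auto

lemma abel_append: "abel (u @ v) = abel u + abel v"
  by (simp add: abel_def vec_eq_iff)

lemma abel_Nil [simp]: "abel [] = 0"
  by (simp add: abel_def vec_eq_iff)

lemma abel_singleton: "abel [a] = axis a 1"
  by (auto simp: abel_def vec_eq_iff axis_def)

section \<open>Legal words and the prefix language\<close>

lemma legal_sublist: "legal \<theta> v \<Longrightarrow> sublist u v \<Longrightarrow> u \<noteq> [] \<Longrightarrow> legal \<theta> u"
  unfolding legal_def by (blast intro: sublist_order.order_trans)

lemma legalI: "x \<in> subst_iter \<theta> k [a] \<Longrightarrow> sublist u x \<Longrightarrow> u \<noteq> [] \<Longrightarrow> legal \<theta> u"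
  by (auto simp: legal_def)

lemma subst_seqs_prefix:
  assumes "y \<in> (subst_seqs \<theta> ^^ n) X"
  shows "\<exists>b. \<exists>v\<in>subst_iter \<theta> n [b]. map y [0..<length v] = v"
  using assms
proof (induction n arbitrary: y)
  case 0
  show ?case by (auto intro: exI[of _ "y 0"])
next
  case (Suc n)
  then obtain x where x: "x \<in> (subst_seqs \<theta> ^^ n) X" "y \<in> subst_seq \<theta> x"
    unfolding funpow.simps o_apply subst_seqs_def by blast
  then obtain b v where v: "v \<in> subst_iter \<theta> n [b]" "map x [0..<length v] = v"
    using Suc.IH by blast
  from x(2) obtain vs where vs: "\<And>i. vs i \<in> \<theta> (x i)" "is_inf_concat vs y"
    by (auto simp: subst_seq_def)
  define p where "p = concat (map vs [0..<length v])"
  have "list_all2 (\<lambda>v a. v \<in> \<theta> a) (map vs [0..<length v]) (map x [0..<length v])"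
    by (simp add: list_all2_conv_all_nth vs(1))
  hence "p \<in> subst_word \<theta> v"
    unfolding v(2) by (auto simp: p_def subst_word_def)
  hence "p \<in> subst_iter \<theta> (Suc n) [b]"
    using v(1) by (auto simp: subst_iter_Suc)
  moreover have "map y [0..<length p] = p"
    using vs(2) by (auto simp: is_inf_concat_def p_def Let_def)
  ultimately show ?case by blast
qed

text \<open>
  Infinitely many levels suffice to reach every level: a word of level \<open>n \<ge> N\<close> beginning with \<open>a\<close>
  begins with the level-\<open>N\<close> inflation of some letter.
\<close>

lemma initial_letter_everywhere:
  assumes "random_subst \<theta>" "a \<in> initial_letters \<theta>"
  shows "\<exists>b. \<exists>v\<in>subst_iter \<theta> N [b]. prefix [a] v"
proof -
  from assms(2) obtain b where "infinite {n. \<exists>v\<in>subst_iter \<theta> n [b]. prefix [a] v}"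
    by (auto simp: initial_letters_def)
  then obtain n v where n: "n \<ge> N" "v \<in> subst_iter \<theta> n [b]" "prefix [a] v"
    unfolding infinite_nat_iff_unbounded_le by blast
  then obtain u where u: "u \<in> subst_iter \<theta> (n - N) [b]" "v \<in> subst_iter \<theta> N u"
    using subst_iter_add[of \<theta> "n - N" N "[b]"] by auto
  then obtain c u' where "u = c # u'"
    using subst_iter_not_Nil[OF assms(1) _ u(1)] by (cases u) auto
  with u(2) obtain x y where x: "v = x @ y" "x \<in> subst_iter \<theta> N [c]"
    by (auto elim: subst_iter_ConsE)
  moreover have "x \<noteq> []"
    using subst_iter_not_Nil[OF assms(1) _ x(2)] by simp
  ultimately have "prefix [a] x"
    using n(3) by (cases x) auto
  with x(2) show ?thesis by blast
qed

text \<open>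
  Quantifying over all large \<open>N\<close> matters: finitely many words of the prefix language can be
  realised simultaneously at one and the same level, which is what the next lemma needs.
\<close>

lemma prefix_language_everywhere:
  assumes "random_subst \<theta>" "z \<in> prefix_language \<theta>"
  shows "\<forall>\<^sub>F N in sequentially. \<exists>b. \<exists>V\<in>subst_iter \<theta> N [b]. prefix z V"
proof -
  from assms(2) obtain k a x where z: "a \<in> initial_letters \<theta>" "x \<in> subst_iter \<theta> k [a]" "prefix z x"
    by (auto simp: prefix_language_def)
  have "\<exists>b. \<exists>V\<in>subst_iter \<theta> N [b]. prefix z V" if "N \<ge> k" for N
  proof -
    obtain b v where v: "v \<in> subst_iter \<theta> (N - k) [b]" "prefix [a] v"
      using initial_letter_everywhere[OF assms(1) z(1)] by blast
    then obtain v' where "v = [a] @ v'" by (auto simp: prefix_def)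
    moreover obtain y where "y \<in> subst_iter \<theta> k v'"
      using subst_iter_nonempty[OF assms(1)] by blast
    ultimately have "x @ y \<in> subst_iter \<theta> k v"
      using z(2) by (auto intro: subst_iter_ConsI)
    hence "x @ y \<in> subst_iter \<theta> N [b]"
      using subst_iter_addI[OF v(1)] that by fastforce
    thus ?thesis
      using z(3) by (auto intro: prefix_prefix)
  qed
  thus ?thesis
    unfolding eventually_sequentially by blast
qed

text \<open>
  The choices of realisations at different letters of a word are independent.  Each block \<open>B\<close>
  contains every letter, hence offers a place to put one prescribed word at the beginning of an
  inflated letter.  The part \<open>X\<close> to the left of that word is then a full inflation of a prefix
  of \<open>concat Bs\<close>.
\<close>

lemma realise_words:
  assumes "random_subst \<theta>" "length zs \<le> length Bs"
    and "\<And>B. B \<in> set Bs \<Longrightarrow> set B = UNIV"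
    and "\<And>z. z \<in> set zs \<Longrightarrow> \<exists>b. \<exists>V\<in>subst_iter \<theta> N [b]. prefix z V"
  shows "\<exists>W\<in>subst_iter \<theta> N (concat Bs). \<forall>z\<in>set zs. \<exists>U X Y.
           prefix U (concat Bs) \<and> X \<in> subst_iter \<theta> N U \<and> W = X @ z @ Y"
  using assms(2-)
proof (induction Bs arbitrary: zs)
  case Nil
  thus ?case by simp
next
  case (Cons B Bs)
  show ?case
  proof (cases zs)
    case Nil
    thus ?thesis
      using subst_iter_nonempty[OF assms(1)] by auto
  next
    case zs: (Cons z zs')
    obtain W where W: "W \<in> subst_iter \<theta> N (concat Bs)"
        "\<And>z. z \<in> set zs' \<Longrightarrow> \<exists>U X Y. prefix U (concat Bs) \<and> X \<in> subst_iter \<theta> N U \<and> W = X @ z @ Y"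
      using Cons.IH[of zs'] Cons.prems zs by auto
    obtain b V where V: "V \<in> subst_iter \<theta> N [b]" "prefix z V"
      using Cons.prems(3)[of z] zs by auto
    obtain V' where V': "V = z @ V'"
      using V(2) by (auto simp: prefix_def)
    have "b \<in> set B"
      using Cons.prems(2)[of B] by simp
    then obtain p s where B: "B = p @ [b] @ s"
      by (auto dest: split_list)
    obtain P S where P: "P \<in> subst_iter \<theta> N p" and S: "S \<in> subst_iter \<theta> N s"
      using subst_iter_nonempty[OF assms(1)] by blast
    have PVS: "P @ V @ S \<in> subst_iter \<theta> N B"
      unfolding B by (intro subst_iter_appendI P V(1) S)
    have "\<exists>U X Y. prefix U (concat (B # Bs)) \<and> X \<in> subst_iter \<theta> N U \<and> (P @ V @ S) @ W = X @ z' @ Y"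
      if z': "z' \<in> set zs" for z'
    proof (cases "z' = z")
      case True
      thus ?thesis
        using P by (intro exI[of _ p] exI[of _ P] exI[of _ "V' @ S @ W"]) (auto simp: B V')
    next
      case False
      then obtain U X Y where "prefix U (concat Bs)" "X \<in> subst_iter \<theta> N U" "W = X @ z' @ Y"
        using W(2)[of z'] z' zs False by auto
      thus ?thesis
        using subst_iter_appendI[OF PVS, of X U]
        by (intro exI[of _ "B @ U"] exI[of _ "(P @ V @ S) @ X"] exI[of _ Y]) auto
    qed
    moreover have "(P @ V @ S) @ W \<in> subst_iter \<theta> N (concat (B # Bs))"
      using subst_iter_appendI[OF PVS W(1)] by simp
    ultimately show ?thesis by blast
  qed
qed

section \<open>Cylinders and translations\<close>

lemma funpow_shift: "(shift ^^ n) w i = w (n + i)"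
  by (induction n arbitrary: i) (auto simp: shift_def)

lemma openin_full_shift_cylinder: "openin full_shift {y. \<forall>i<l. y i = x i}"
proof -
  have "{y. \<forall>i<l. y i = x i} = PiE UNIV (\<lambda>i. if i < l then {x i} else UNIV)"
    by (auto simp: PiE_def Pi_def split: if_splits)
  moreover have "{i. (if i < l then {x i} else UNIV) \<noteq> UNIV} \<subseteq> {..<l}"
    by auto
  hence "finite {i. (if i < l then {x i} else UNIV) \<noteq> UNIV}"
    by (rule finite_subset) simp
  ultimately show ?thesis
    unfolding full_shift_def by (auto intro!: product_topology_basis)
qed

text \<open>
  Let \<open>f\<close> be the element of \<open>F\<close> furthest in the direction of \<open>t\<close>.  Its translate \<open>t + f\<close> overshoots
  every element of \<open>F\<close> in that direction by at least the length of \<open>t\<close>.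
\<close>

lemma translation_small_if_almost_preserves:
  fixes F :: "'v::real_inner set"
  assumes "finite F" "F \<noteq> {}" and "\<And>f. f \<in> F \<Longrightarrow> \<exists>f'\<in>F. norm (t + f - f') \<le> \<eta>"
  shows "norm t \<le> \<eta>"
proof -
  obtain f where f: "f \<in> F" "\<And>f'. f' \<in> F \<Longrightarrow> t \<bullet> f' \<le> t \<bullet> f"
    using finite_has_maximal[of "(\<lambda>f. t \<bullet> f) ` F"] assms(1,2)
    by (metis (no_types, lifting) Max_ge Max_in finite_imageI imageE image_eqI image_is_empty)
  from assms(3)[OF f(1)] obtain f' where f': "f' \<in> F" "norm (t + f - f') \<le> \<eta>" by blast
  have "norm t * norm t = t \<bullet> (t + f - f') + (t \<bullet> f' - t \<bullet> f)"
    by (simp add: inner_diff_right inner_add_right flip: power2_eq_square power2_norm_eq_inner)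
  also have "\<dots> \<le> norm t * norm (t + f - f') + 0"
    using f(2)[OF f'(1)] norm_cauchy_schwarz by (intro add_mono) auto
  finally have "norm t \<le> norm (t + f - f') \<or> norm t = 0"
    by (auto simp: mult_le_cancel_left)
  thus ?thesis
    using f'(2) norm_ge_zero[of "t + f - f'"] by linarith
qed

section \<open>Positions in Pisot random substitutions\<close>

context pisot_random_subst
begin

text \<open>
  The projected abelianisation of the prefix that precedes a letter is the point that this
  occurrence of the letter contributes to the fractal.
\<close>

abbreviation pos :: "'a list \<Rightarrow> real ^ 'a" where
  "pos u \<equiv> \<pi> (abel u)"

lemma pos_append: "pos (u @ v) = pos u + pos v"
  by (simp add: abel_append \<pi>_add)

lemma abel_subst_word: "v \<in> subst_word \<theta> u \<Longrightarrow> abel v = M *v abel u"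
proof (induction u arbitrary: v)
  case (Cons a u)
  from Cons.prems obtain x y where "v = x @ y" "x \<in> \<theta> a" "y \<in> subst_word \<theta> u"
    by (auto simp: subst_word_Cons)
  moreover have "abel x = M *v abel [a]" if "x \<in> \<theta> a" for x
    unfolding abel_singleton matrix_vector_mult_basis
    using subst_matrix_nth[OF compat that, where 'b = real] by (simp add: column_def abel_def)
  ultimately show ?case
    using Cons.IH abel_append[of "[a]" u] by (simp add: abel_append matrix_vector_right_distrib)
qed simp

lemma abel_subst_iter: "v \<in> subst_iter \<theta> n u \<Longrightarrow> abel v = M_pow n (abel u)"
  by (induction n arbitrary: v) (auto simp: subst_iter_Suc abel_subst_word)

text \<open>
  Weighting letters by the left eigenvector \<open>L\<close> turns every substitution step into a
  multiplication by \<open>\<beta> > 1\<close>, and the weight of a word is comparable with its length.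
\<close>

lemma subst_iter_length_unbounded: "\<exists>k. \<forall>c. \<forall>v\<in>subst_iter \<theta> k [c]. m \<le> length v"
proof -
  \<comment> \<open>The weight of a letter lies between \<open>l\<close> and \<open>s\<close>.\<close>
  define l s where "l = Min (range (\<lambda>i. L $ i))" and "s = (\<Sum>i\<in>UNIV. L $ i)"
  have l: "0 < l" "l \<le> L $ i" for i
    unfolding l_def using L_pos by (auto simp: Min_gr_iff)
  have s: "L $ i \<le> s" for i
    unfolding s_def by (intro member_le_sum) (auto intro: less_imp_le[OF L_pos])
  have s0: "s > 0"
    using L_pos s less_le_trans by blast
  have abel_le: "L \<bullet> abel v \<le> s * real (length v)" for v
  proof (induction v)
    case (Cons a v)
    have "L \<bullet> abel (a # v) = L $ a + L \<bullet> abel v"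
      using abel_append[of "[a]" v] by (simp add: inner_add_right abel_singleton inner_axis)
    with Cons s[of a] show ?case
      by (simp add: algebra_simps)
  qed simp
  obtain k where k: "s * real m / l < \<beta> ^ k"
    using real_arch_pow[OF \<beta>_gt_1] by blast
  have "m \<le> length v" if "v \<in> subst_iter \<theta> k [c]" for c v
  proof -
    have "s * real m \<le> \<beta> ^ k * l"
      using k l(1) by (simp add: field_simps)
    also have "\<dots> \<le> \<beta> ^ k * L $ c"
      using l(2) \<beta>_gt_1 by (intro mult_left_mono) auto
    also have "\<dots> = L \<bullet> abel v"
      using abel_subst_iter[OF that] by (simp add: L_inner_M_pow abel_singleton inner_axis)
    also have "\<dots> \<le> s * real (length v)"
      by (rule abel_le)
    finally show ?thesis
      using s0 by simp
  qed
  thus ?thesis by blast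
qed

lemma subst_iter_eventually_full: "\<exists>k. \<forall>c. \<forall>v\<in>subst_iter \<theta> k [c]. set v = UNIV"
proof -
  obtain k where k: "\<And>i j. ((\<lambda>A. M ** A) ^^ k) (mat 1) $ i $ j > 0"
    using primitive by (auto simp: primitive_matrix_def)
  have "i \<in> set v" if "v \<in> subst_iter \<theta> k [c]" for c v i
  proof -
    have "abel v $ i = ((\<lambda>A. M ** A) ^^ k) (mat 1) $ i $ c"
      unfolding abel_subst_iter[OF that] primitive_matrix_power_vec[symmetric]
      by (simp add: abel_singleton matrix_vector_mult_basis column_def)
    with k have "count_list v i > 0"
      by (simp add: abel_def) (metis of_nat_0_less_iff)
    thus ?thesis
      by (metis count_list_0_iff less_irrefl)
  qed
  thus ?thesis by blast
qed

text \<open>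
  Inflate each letter of a long word of level \<open>j\<close> by a fixed number \<open>k\<close> of steps after which
  every letter occurs.
\<close>

lemma legal_blocks:
  "\<exists>k a Bs. m \<le> length Bs \<and> (\<forall>B\<in>set Bs. set B = UNIV) \<and> concat Bs \<in> subst_iter \<theta> k [a]"
proof -
  obtain j where j: "\<And>c v. v \<in> subst_iter \<theta> j [c] \<Longrightarrow> m \<le> length v"
    using subst_iter_length_unbounded by blast
  obtain k where k: "\<And>c v. v \<in> subst_iter \<theta> k [c] \<Longrightarrow> set v = UNIV"
    using subst_iter_eventually_full by blast
  fix a
  obtain y where y: "y \<in> subst_iter \<theta> j [a]"
    using subst_iter_nonempty[OF random] by blast
  obtain f where f: "\<And>c. f c \<in> subst_iter \<theta> k [c]"
    using choice[of "\<lambda>c v. v \<in> subst_iter \<theta> k [c]"] subst_iter_nonempty[OF random] by blast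
  have "concat (map f y) \<in> subst_iter \<theta> (j + k) [a]"
    using f by (intro subst_iter_addI[OF y] subst_iter_concat_map)
  moreover have "\<forall>B\<in>set (map f y). set B = UNIV"
    using k f by auto
  ultimately show ?thesis
    using j[OF y] by (metis length_map)
qed

text \<open>
  A legal word sits inside an inflated letter \<open>a\<close>, and \<open>a\<close> occurs in the first of two consecutive
  full blocks of a legal word; whatever follows that occurrence inflates to something nonempty.
\<close>

lemma legal_extend:
  assumes "legal \<theta> u"
  shows "\<exists>c. legal \<theta> (u @ [c])"
proof -
  from assms obtain a k V where V: "V \<in> subst_iter \<theta> k [a]" "sublist u V"
    by (auto simp: legal_def)
  then obtain p s where ps: "V = p @ u @ s" by (auto simp: sublist_def)
  \<comment> \<open>Two blocks: the second one guarantees that something follows \<open>a\<close>.\<close>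
  obtain k' a' Bs where Bs: "2 \<le> length Bs" "\<And>B. B \<in> set Bs \<Longrightarrow> set B = UNIV"
      "concat Bs \<in> subst_iter \<theta> k' [a']"
    using legal_blocks[of 2] by blast
  then obtain B1 B2 Bs' where Bs': "Bs = B1 # B2 # Bs'"
    by (auto simp: Suc_le_length_iff numeral_2_eq_2)
  have "a \<in> set B1" and "B2 \<noteq> []"
    using Bs(2)[of B1] Bs(2)[of B2] Bs' by auto
  then obtain q1 q2 where q: "B1 = q1 @ a # q2" by (auto dest: split_list)
  define r where "r = q2 @ B2 @ concat Bs'"
  have "r \<noteq> []" using \<open>B2 \<noteq> []\<close> by (simp add: r_def)
  obtain x y where xy: "x \<in> subst_iter \<theta> k q1" "y \<in> subst_iter \<theta> k r"
    using subst_iter_nonempty[OF random] by blast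
  have "x @ V @ y \<in> subst_iter \<theta> k (q1 @ [a] @ r)"
    by (intro subst_iter_appendI xy V)
  also have "q1 @ [a] @ r = concat Bs"
    by (simp add: Bs' q r_def)
  finally have xVy: "x @ V @ y \<in> subst_iter \<theta> (k' + k) [a']"
    by (rule subst_iter_addI[OF Bs(3)])
  have "y \<noteq> []"
    using subst_iter_not_Nil[OF random \<open>r \<noteq> []\<close> xy(2)] .
  then obtain c t where "s @ y = c # t"
    by (metis append_is_Nil_conv neq_Nil_conv)
  hence "x @ V @ y = (x @ p) @ (u @ [c]) @ t"
    by (simp add: ps)
  hence "sublist (u @ [c]) (x @ V @ y)"
    unfolding sublist_def by blast
  with xVy show ?thesis
    by (auto intro!: legalI)
qed

text \<open>
  Extend the word one letter at a time.  All prefixes of the limit sequence are legal, hence so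
  are all its subwords.
\<close>

lemma legal_word_begins_point:
  assumes "legal \<theta> u"
  shows "\<exists>x\<in>subshift \<theta>. map x [0..<length u] = u"
proof -
  \<comment> \<open>\<open>g n\<close> is the word after \<open>n\<close> extensions, so that \<open>g (Suc i)\<close> is long enough to have a letter at \<open>i\<close>.\<close>
  define g where "g = rec_nat u (\<lambda>_ v. v @ [SOME c. legal \<theta> (v @ [c])])"
  have g0: "g 0 = u" and gS: "g (Suc n) = g n @ [SOME c. legal \<theta> (g n @ [c])]" for n
    by (simp_all add: g_def)
  have legal_g: "legal \<theta> (g n)" for n
  proof (induction n)
    case (Suc n)
    thus ?case
      unfolding gS by (intro someI_ex[of "\<lambda>c. legal \<theta> (g n @ [c])"] legal_extend)
  qed (simp add: g0 assms)
  have len: "length (g n) = length u + n" for n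
    by (induction n) (auto simp: g0 gS)
  define x where "x i = g (Suc i) ! i" for i
  have nth: "g n ! i = x i" if "i < length u + n" for n i
    using that
  proof (induction n)
    case 0
    have "g k ! i = u ! i" for k
      using 0 by (induction k) (auto simp: g0 gS nth_append len)
    thus ?case by (simp add: x_def)
  next
    case (Suc n)
    show ?case
    proof (cases "i < length u + n")
      case True
      thus ?thesis using Suc.IH by (simp add: gS nth_append len)
    next
      case False
      with Suc.prems have i: "i = length u + n" by simp
      have "g (Suc n + k) ! i = g (Suc n) ! i" for k
        by (induction k) (auto simp: gS nth_append len i)
      from this[of "length u"] show ?thesis
        by (simp add: x_def i add.commute)
    qed
  qed
  have map_x: "map x [0..<length u + n] = g n" for n
    by (rule nth_equalityI) (auto simp: len nth)
  have "legal \<theta> (map x [i..<j])" if "i < j" for i j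
  proof (rule legal_sublist[OF legal_g[of j]])
    have "[0..<length u + j] = [0..<i] @ [i..<j] @ [j..<length u + j]"
      using that upt_add_eq_append[of 0 i "j - i"] upt_add_eq_append[of 0 j "length u"]
      by (simp add: add.commute)
    hence "g j = map x [0..<i] @ map x [i..<j] @ map x [j..<length u + j]"
      by (metis map_append map_x)
    thus "sublist (map x [i..<j]) (g j)"
      unfolding sublist_def by blast
  qed (use that in auto)
  hence "x \<in> subshift \<theta>"
    by (simp add: subshift_def)
  with map_x[of 0] show ?thesis
    by (auto simp: g0)
qed

lemma legal_word_occurs:
  assumes dense: "(subtopology full_shift (subshift \<theta>)) closure_of (shift_orbit w) = subshift \<theta>"
    and "legal \<theta> u"
  shows "\<exists>p. map w [p..<p + length u] = u"
proof -
  obtain x where x: "x \<in> subshift \<theta>" "map x [0..<length u] = u"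
    using legal_word_begins_point[OF assms(2)] by blast
  define T where "T = {y. \<forall>i<length u. y i = x i} \<inter> subshift \<theta>"
  have "openin (subtopology full_shift (subshift \<theta>)) T"
    unfolding T_def by (intro openin_subtopology_Int openin_full_shift_cylinder)
  moreover have "x \<in> T"
    using x(1) by (simp add: T_def)
  moreover have "x \<in> (subtopology full_shift (subshift \<theta>)) closure_of (shift_orbit w)"
    unfolding dense by (rule x(1))
  ultimately obtain y where "y \<in> shift_orbit w" "y \<in> T"
    unfolding in_closure_of by blast
  then obtain n where n: "\<And>i. i < length u \<Longrightarrow> (shift ^^ n) w i = x i"
    by (auto simp: shift_orbit_def T_def)
  have "map w [n..<n + length u] = map x [0..<length u]"
    using n by (intro nth_equalityI) (auto simp: funpow_shift)
  with x(2) show ?thesis by auto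
qed

text \<open>
  The position of a prefix is, up to one last letter, a sum over the levels \<open>m\<close> of
  \<open>\<pi> (M\<^sup>m \<psi>(p))\<close>, where each \<open>p\<close> is a prefix of a realisation of some letter.  There are finitely
  many such \<open>p\<close>, and each contributes a summable series.
\<close>

lemma pos_bounded: "\<exists>C. \<forall>n a. \<forall>x\<in>subst_iter \<theta> n [a]. \<forall>v. prefix v x \<longrightarrow> norm (pos v) \<le> C"
proof -
  define F where "F = (\<Union>a. \<Union>x\<in>\<theta> a. set (prefixes x))"
  have fin: "finite F"
    using random by (auto simp: F_def random_subst_def)
  define b where "b n = (\<Sum>p\<in>F. norm (\<pi> (M_pow n (abel p))))" for n
  define C0 where "C0 = (\<Sum>a\<in>UNIV. norm (pos [a]))"
  have b_sum: "summable b"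
    unfolding b_def by (intro summable_sum summable_\<pi>_M_pow)
  have b_pos: "b n \<ge> 0" for n
    by (simp add: b_def sum_nonneg)
  have "norm (pos v) \<le> C0 + (\<Sum>m<n. b m)" if "x \<in> subst_iter \<theta> n [a]" "prefix v x" for n a x v
    using that
  proof (induction n arbitrary: a x v)
    case 0
    hence "v = [] \<or> v = [a]"
      by (auto simp: prefix_Cons)
    moreover have "norm (pos [a]) \<le> C0"
      unfolding C0_def by (rule member_le_sum) auto
    moreover have "C0 \<ge> 0"
      by (simp add: C0_def sum_nonneg)
    ultimately show ?case
      by (auto simp: \<pi>_eq)
  next
    case (Suc n)
    then obtain V where V: "V \<in> \<theta> a" "x \<in> subst_iter \<theta> n V"
      using subst_iter_add[of \<theta> "Suc 0" n "[a]"] by (auto simp: subst_iter_Suc[of _ 0])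
    hence "V \<noteq> []"
      using random by (auto simp: random_subst_def)
    then obtain u1 c u2 y z z' where d: "V = u1 @ c # u2" "v = y @ z" "y \<in> subst_iter \<theta> n u1"
        "z' \<in> subst_iter \<theta> n [c]" "prefix z z'"
      using prefix_subst_iterE[OF V(2) Suc.prems(2)] by blast
    have "u1 \<in> F"
      using V(1) d(1) unfolding F_def by (force simp: prefix_def)
    hence "norm (\<pi> (M_pow n (abel u1))) \<le> b n"
      unfolding b_def by (intro member_le_sum fin) auto
    hence "norm (pos y) \<le> b n"
      using abel_subst_iter[OF d(3)] by simp
    moreover have "norm (pos z) \<le> C0 + (\<Sum>m<n. b m)"
      using Suc.IH[OF d(4,5)] .
    ultimately show ?case
      using norm_triangle_ineq[of "pos y" "pos z"] by (simp add: d(2) pos_append)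
  qed
  moreover have "(\<Sum>m<n. b m) \<le> suminf b" for n
    by (intro sum_le_suminf b_sum) (auto simp: b_pos)
  ultimately show ?thesis
    by (intro exI[of _ "C0 + suminf b"]) (meson add_left_mono order_trans)
qed

lemma bounded_pos_prefix_language: "bounded {pos v | v c. v @ [c] \<in> prefix_language \<theta>}"
proof -
  obtain C where C: "\<And>n a x v. x \<in> subst_iter \<theta> n [a] \<Longrightarrow> prefix v x \<Longrightarrow> norm (pos v) \<le> C"
    using pos_bounded by blast
  have "norm (pos v) \<le> C" if "v @ [c] \<in> prefix_language \<theta>" for v c
    using that C by (auto simp: prefix_language_def dest: append_prefixD)
  thus ?thesis
    unfolding bounded_iff by blast
qed

text \<open>
  Fix \<open>k\<close> so large that every level-\<open>k\<close> word is at least as long as the prefix.  For every \<open>n\<close>, the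
  sequence \<open>w\<close> begins with a word of level \<open>n + k\<close>, so the prefix lies in the level-\<open>k\<close> inflation of
  a letter \<open>c\<close> that begins a word of level \<open>n\<close> over some letter \<open>b\<close>.  Some pair \<open>(b, c)\<close> serves
  infinitely many \<open>n\<close>, and then \<open>c\<close> is an initial letter.
\<close>

lemma prefix_in_prefix_language:
  assumes "w \<in> subshift_inf \<theta>"
  shows "map w [0..<Suc m] \<in> prefix_language \<theta>"
proof -
  obtain k where k: "\<And>c v. v \<in> subst_iter \<theta> k [c] \<Longrightarrow> Suc m \<le> length v"
    using subst_iter_length_unbounded by blast
  define Q where "Q n b c \<longleftrightarrow> (\<exists>u\<in>subst_iter \<theta> n [b]. prefix [c] u) \<and>
      (\<exists>x\<in>subst_iter \<theta> k [c]. prefix (map w [0..<Suc m]) x)" for n b c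
  have "\<exists>b c. Q n b c" for n
  proof -
    have "w \<in> (subst_seqs \<theta> ^^ (n + k)) (subshift \<theta>)"
      using assms by (auto simp: subshift_inf_def)
    then obtain b v where v: "v \<in> subst_iter \<theta> (n + k) [b]" "map w [0..<length v] = v"
      using subst_seqs_prefix by blast
    then obtain u where u: "u \<in> subst_iter \<theta> n [b]" "v \<in> subst_iter \<theta> k u"
      by (auto simp: subst_iter_add)
    then obtain c u' where c: "u = c # u'"
      using subst_iter_not_Nil[OF random _ u(1)] by (cases u) auto
    with u(2) obtain x y where x: "v = x @ y" "x \<in> subst_iter \<theta> k [c]"
      by (auto elim: subst_iter_ConsE)
    have "map w [0..<Suc m] = take (Suc m) v"
      using k[OF x(2)] x(1) by (subst v(2)[symmetric]) (simp add: take_map del: upt_Suc)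
    hence "prefix (map w [0..<Suc m]) v"
      by (simp only: take_is_prefix)
    hence "prefix (map w [0..<Suc m]) x"
      using k[OF x(2)] x(1) by (intro prefix_length_prefix[of _ v x]) auto
    moreover have "prefix [c] u"
      by (simp add: c)
    ultimately show ?thesis
      unfolding Q_def using x(2) u(1) by blast
  qed
  then obtain f g where fg: "\<And>n. Q n (f n) (g n)" by metis
  have "\<exists>bc. infinite {n. (f n, g n) = bc}"
  proof (rule ccontr)
    assume "\<not> ?thesis"
    hence "finite (\<Union>bc. {n. (f n, g n) = bc})"
      by (intro finite_UN_I) auto
    moreover have "(\<Union>bc. {n. (f n, g n) = bc}) = UNIV" by auto
    ultimately show False by simp
  qed
  then obtain b c where bc: "infinite {n. f n = b \<and> g n = c}" by auto
  hence "infinite {n. \<exists>u\<in>subst_iter \<theta> n [b]. prefix [c] u}"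
    by (rule infinite_super[rotated]) (use fg in \<open>auto simp: Q_def\<close>)
  hence "c \<in> initial_letters \<theta>"
    by (auto simp: initial_letters_def)
  moreover obtain n where "f n = b" "g n = c"
    using bc by (metis (mono_tags, lifting) Collect_empty_eq finite.emptyI)
  with fg[of n] have "\<exists>x\<in>subst_iter \<theta> k [c]. prefix (map w [0..<Suc m]) x"
    by (auto simp: Q_def)
  ultimately show ?thesis
    unfolding prefix_language_def by auto
qed

text \<open>
  Choose the word \<open>U\<close> of blocks first, depending only on the number of words to be realised, and
  the level \<open>N\<close> afterwards: the words are preceded by inflations of one of the finitely many
  prefixes of \<open>U\<close>, whose projections tend to \<open>0\<close> as \<open>N\<close> grows.
\<close>

lemma legal_word_realising:
  assumes Z: "finite Z" "Z \<subseteq> prefix_language \<theta>" and "\<epsilon> > 0"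
  shows "\<exists>W. legal \<theta> W \<and> (\<forall>z\<in>Z. \<exists>X Y. W = X @ z @ Y \<and> norm (pos X) < \<epsilon>)"
proof -
  obtain zs where zs: "set zs = Z"
    using finite_list Z(1) by blast
  obtain k a Bs where Bs: "length zs \<le> length Bs" "\<And>B. B \<in> set Bs \<Longrightarrow> set B = UNIV"
      "concat Bs \<in> subst_iter \<theta> k [a]"
    using legal_blocks[of "length zs"] by blast
  have "\<forall>\<^sub>F N in sequentially. \<forall>z\<in>Z. \<exists>b. \<exists>V\<in>subst_iter \<theta> N [b]. prefix z V"
    using Z prefix_language_everywhere[OF random] by (intro eventually_ball_finite) auto
  moreover have "\<forall>\<^sub>F N in sequentially. \<forall>U\<in>set (prefixes (concat Bs)).
      norm (\<pi> (M_pow N (abel U))) < \<epsilon>"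
  proof (intro eventually_ball_finite ballI)
    fix U
    have "(\<lambda>N. norm (\<pi> (M_pow N (abel U)))) \<longlonglongrightarrow> 0"
      by (rule summable_LIMSEQ_zero[OF summable_\<pi>_M_pow])
    thus "\<forall>\<^sub>F N in sequentially. norm (\<pi> (M_pow N (abel U))) < \<epsilon>"
      using \<open>\<epsilon> > 0\<close> by (rule order_tendstoD)
  qed simp
  ultimately have "\<forall>\<^sub>F N in sequentially. (\<forall>z\<in>Z. \<exists>b. \<exists>V\<in>subst_iter \<theta> N [b]. prefix z V) \<and>
      (\<forall>U\<in>set (prefixes (concat Bs)). norm (\<pi> (M_pow N (abel U))) < \<epsilon>)"
    by (rule eventually_conj)
  then obtain N where "(\<forall>z\<in>Z. \<exists>b. \<exists>V\<in>subst_iter \<theta> N [b]. prefix z V) \<and>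
      (\<forall>U\<in>set (prefixes (concat Bs)). norm (\<pi> (M_pow N (abel U))) < \<epsilon>)"
    using eventually_happens'[OF sequentially_bot] by blast
  hence N: "\<And>z. z \<in> Z \<Longrightarrow> \<exists>b. \<exists>V\<in>subst_iter \<theta> N [b]. prefix z V"
      "\<And>U. prefix U (concat Bs) \<Longrightarrow> norm (\<pi> (M_pow N (abel U))) < \<epsilon>"
    by auto
  obtain W where W: "W \<in> subst_iter \<theta> N (concat Bs)" "\<And>z. z \<in> set zs \<Longrightarrow> \<exists>U X Y.
           prefix U (concat Bs) \<and> X \<in> subst_iter \<theta> N U \<and> W = X @ z @ Y"
    using realise_words[OF random Bs(1,2), of N] N(1) zs by blast
  have Wk: "W \<in> subst_iter \<theta> (k + N) [a]"
    by (rule subst_iter_addI[OF Bs(3) W(1)])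
  have "legal \<theta> W"
    using subst_iter_not_Nil[OF random _ Wk] by (intro legalI[OF Wk]) auto
  moreover have "\<exists>X Y. W = X @ z @ Y \<and> norm (pos X) < \<epsilon>" if "z \<in> Z" for z
    using W(2)[of z] that zs N(2) by (metis abel_subst_iter)
  ultimately show ?thesis by blast
qed

section \<open>The two fractals coincide\<close>

text \<open>
  For the inclusion from right to left, let \<open>F\<close> be a fine net of the bounded set \<open>D\<close> of all
  positions in the prefix language.  One legal word \<open>W\<close> realises, up to a small error, all points
  of \<open>F\<close> together with the given point, and \<open>W\<close> occurs in \<open>w\<close> after some prefix with position \<open>t\<close>.
  Every position in \<open>w\<close> belongs to \<open>D\<close>, so translation by \<open>t\<close> almost maps \<open>F\<close> into itself and
  \<open>t\<close> must be small.  Hence the occurrence of the given word inside \<open>W\<close> yields a point of the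
  fractal of \<open>w\<close> near the given one.
\<close>

theorem rauzy_eq_rauzy_hat:
  assumes w: "w \<in> subshift_inf \<theta>"
    and dense: "(subtopology full_shift (subshift \<theta>)) closure_of (shift_orbit w) = subshift \<theta>"
  shows "rauzy L R w a = rauzy_hat L R \<theta> a"
proof
  have Suc_prefix: "map w [0..<n] @ [w n] \<in> prefix_language \<theta>" for n
    using prefix_in_prefix_language[OF w, of n] by simp
  have "prefix_abels w a \<subseteq> language_abels (prefix_language \<theta>) a"
    using Suc_prefix by (auto simp: prefix_abels_def language_abels_def)
  thus "rauzy L R w a \<subseteq> rauzy_hat L R \<theta> a"
    unfolding rauzy_def rauzy_hat_def by (intro closure_mono image_mono)
  let ?S = "\<pi> ` prefix_abels w a"
  have "pos v \<in> closure ?S" if v: "v @ [a] \<in> prefix_language \<theta>" for v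
    unfolding closure_approachable
  proof (intro allI impI)
    fix \<epsilon> :: real assume "\<epsilon> > 0"
    \<comment> \<open>The total error is at most three times \<open>\<eta>\<close>: twice for \<open>t\<close> and once for the realisation.\<close>
    define \<eta> where "\<eta> = \<epsilon> / 4"
    have \<eta>: "\<eta> > 0" using \<open>\<epsilon> > 0\<close> by (simp add: \<eta>_def)
    define D where "D = {pos v | v c. v @ [c] \<in> prefix_language \<theta>}"
    have "bounded D"
      unfolding D_def by (rule bounded_pos_prefix_language)
    hence "compact (closure D)"
      by (simp add: compact_closure)
    moreover have "closure D \<subseteq> (\<Union>f\<in>D. ball f \<eta>)"
      using \<eta> by (auto simp: closure_approachable)
    ultimately obtain F where F: "F \<subseteq> D" "finite F" "closure D \<subseteq> (\<Union>f\<in>F. ball f \<eta>)"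
      by (rule compactE_image[OF _ open_ball])
    have F_net: "D \<subseteq> (\<Union>f\<in>F. ball f \<eta>)"
      using F(3) closure_subset by blast
    have "\<forall>f\<in>F. \<exists>v c. v @ [c] \<in> prefix_language \<theta> \<and> pos v = f"
      using F(1) unfolding D_def by blast
    then obtain z c where c: "\<And>f. f \<in> F \<Longrightarrow> z f @ [c f] \<in> prefix_language \<theta>"
        "\<And>f. f \<in> F \<Longrightarrow> pos (z f) = f"
      by metis
    define Z where "Z = insert (v @ [a]) ((\<lambda>f. z f @ [c f]) ` F)"
    have "finite Z" "Z \<subseteq> prefix_language \<theta>"
      using F(2) v c by (auto simp: Z_def)
    from legal_word_realising[OF this \<eta>] obtain W where W: "legal \<theta> W"
        "\<And>z. z \<in> Z \<Longrightarrow> \<exists>X Y. W = X @ z @ Y \<and> norm (pos X) < \<eta>"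
      by blast
    obtain p where p: "map w [p..<p + length W] = W"
      using legal_word_occurs[OF dense W(1)] by blast
    define t where "t = pos (map w [0..<p])"
    \<comment> \<open>\<open>e\<close> is the position, inside \<open>W\<close>, of the part to the left of the realised word.\<close>
    have occ: "\<exists>e n. norm e < \<eta> \<and> w n = c \<and> pos (map w [0..<n]) = t + e + pos u"
      if uc: "u @ [c] \<in> Z" for u c
    proof -
      obtain X Y where X: "W = X @ (u @ [c]) @ Y" "norm (pos X) < \<eta>"
        using W(2)[OF uc] by blast
      define n where "n = p + length (X @ u)"
      have "take (length (X @ u)) (map w [p..<p + length W]) = X @ u"
        unfolding p by (simp add: X(1))
      hence Xu: "map w [p..<n] = X @ u"
        by (simp add: take_map n_def X(1))
      have "w n = map w [p..<p + length W] ! length (X @ u)"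
        by (subst nth_map) (auto simp: n_def X(1) simp del: upt_Suc)
      also have "\<dots> = c"
        unfolding p by (simp add: X(1) nth_append)
      finally have "w n = c" .
      moreover have "[0..<n] = [0..<p] @ [p..<n]"
        by (simp add: n_def upt_add_eq_append[of 0, simplified])
      hence "pos (map w [0..<n]) = t + pos X + pos u"
        by (simp add: Xu pos_append t_def)
      ultimately show ?thesis
        using X(2) by blast
    qed
    have "norm t \<le> 2 * \<eta>"
    proof (rule translation_small_if_almost_preserves[OF F(2)])
      have "pos v \<in> D"
        using v by (auto simp: D_def)
      thus "F \<noteq> {}"
        using F_net by auto
    next
      fix f assume f: "f \<in> F"
      then obtain e n where e: "norm e < \<eta>" "pos (map w [0..<n]) = t + e + f"
        using occ[of "z f" "c f"] c(2) by (auto simp: Z_def)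
      have "pos (map w [0..<n]) \<in> D"
        using Suc_prefix by (auto simp: D_def)
      then obtain f' where f': "f' \<in> F" "norm (t + e + f - f') < \<eta>"
        using F_net e(2) by (force simp: dist_norm norm_minus_commute)
      have "t + f - f' = (t + e + f - f') - e"
        by simp
      hence "norm (t + f - f') \<le> norm (t + e + f - f') + norm e"
        by (metis norm_triangle_ineq4)
      with e(1) f'(2) have "norm (t + f - f') \<le> 2 * \<eta>"
        by simp
      with f'(1) show "\<exists>f'\<in>F. norm (t + f - f') \<le> 2 * \<eta>"
        by blast
    qed
    moreover obtain e n where e: "norm e < \<eta>" "w n = a" "pos (map w [0..<n]) = t + e + pos v"
      using occ[of v a] by (auto simp: Z_def)
    ultimately have "dist (pos (map w [0..<n])) (pos v) < \<epsilon>"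
      using norm_triangle_ineq[of t e] \<open>\<epsilon> > 0\<close> by (simp add: dist_norm \<eta>_def)
    moreover have "pos (map w [0..<n]) \<in> ?S"
      using e(2) by (auto simp: prefix_abels_def)
    ultimately show "\<exists>y\<in>?S. dist y (pos v) < \<epsilon>"
      by blast
  qed
  hence "\<pi> ` language_abels (prefix_language \<theta>) a \<subseteq> closure ?S"
    by (auto simp: language_abels_def)
  thus "rauzy_hat L R \<theta> a \<subseteq> rauzy L R w a"
    unfolding rauzy_def rauzy_hat_def by (intro closure_minimal) auto
qed

end

theorem theorem4p2:
  fixes \<theta> :: "'a::finite \<Rightarrow> 'a list set"
    and L R :: "real ^ 'a"
    and w :: "nat \<Rightarrow> 'a"
  assumes "random_subst \<theta>"
    and "compatible \<theta>"
    and "irreducible_pisot \<theta>"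
    and "right_pf_eigenvector (subst_matrix \<theta>) R"
    and "left_pf_eigenvector (subst_matrix \<theta>) L"
    and "(\<Sum>i\<in>UNIV. \<bar>R $ i\<bar>) = 1"
    and "L \<bullet> R = 1"
    and "w \<in> subshift_inf \<theta>"
    and "(subtopology full_shift (subshift \<theta>)) closure_of (shift_orbit w) = subshift \<theta>"
  shows "\<forall>a. rauzy L R w a = rauzy_hat L R \<theta> a"
proof -
  interpret pisot_random_subst \<theta> L R
    by unfold_locales (use assms in auto)
  show ?thesis
    using rauzy_eq_rauzy_hat assms(8,9) by blast
qed

end
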